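(* Let $(X,d)$ be a metric space. Then a set $\mathcal A\subset\Pi_{\rm c}(X)$ is precompact (i.e. its closure in $\Pi_{\rm c}(X)$ is compact) if and only if it is equicontinuous and satisfies the compact containment condition.
   Context: Let $\overline{\mathbb R}=[-\infty,\infty]$. The squeezed space is $\mathcal R(X):=(X\times\mathbb R)\cup\{(\ast,-\infty),(\ast,\infty)\}$, equipped with the unique metrisable topology such that $(x_n,t_n)\to(x,t)$ iff $t_n\to t$ in $\overline{\mathbb R}$ and, if $t\in\mathbb R$, also $x_n\to x$. $\Pi(X)$ is the set of pairs $(\pi,\preceq)$ (often just written $\pi$) where $\pi$ is a nonempty compact subset of $\mathcal R(X)$ and $\preceq$ is a total order on $\pi$ such that: (i) $\{(z,z')\in\pi^2:z\preceq z'\}$ is closed in $\pi^2$; (ii) if $(x,s),(x',s')\in\pi$ and $s<s'$, then $(x,s)\preceq(x',s')$; (iii) for each $t\in\mathbb R$ the set $\{x\in X:(x,t)\in\pi\}$ has at most two elements. Put $I(\pi):=\{t\in\mathbb R:(x,t)\in\pi\text{ for some }x\in X\}$. For $t\in I(\pi)$, $\pi(t-),\pi(t+)$ are defined by $\{x:(x,t)\in\pi\}=\{\pi(t-),\pi(t+)\}$ with $(\pi(t-),t)\preceq(\pi(t+),t)$. The space of continuous paths is $\Pi_{\rm c}(X):=\{\pi\in\Pi(X):\pi(t-)=\pi(t+)\ \forall t\in I(\pi)\}$; for $\pi\in\Pi_{\rm c}(X)$ write $\pi(t):=\pi(t-)=\pi(t+)$. The order on a continuous path is determined by the set $\pi$,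 and $\Pi_{\rm c}(X)$ is equipped with the topology generated by the Hausdorff metric on nonempty compact subsets of $\mathcal R(X)$ (for any metric generating the topology of $\mathcal R(X)$). Compact containment condition for $\mathcal A$: for each $T<\infty$ there is a compact $C\subset X$ such that $\pi(t)\in C$ for all $\pi\in\mathcal A$ and $t\in I(\pi)\cap[-T,T]$. Modulus of continuity: for $0<T<\infty$ and $\delta>0$, $m_{T,\delta}(\pi):=\sup\{d(\pi(t_1),\pi(t_2)):t_1,t_2\in I(\pi),\ -T\le t_1<t_2\le T,\ t_2-t_1\le\delta\}$ (with $\sup\emptyset:=0$). $\mathcal A$ is equicontinuous if $\lim_{\delta\to0}\sup_{\pi\in\mathcal A}m_{T,\delta}(\pi)=0$ for all $T<\infty$. *)

theory Defs
  imports "HOL-Analysis.Analysis"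
begin

section \<open>The squeezed space\<close>

datatype 'a squeezed = Pt 'a real | Neg_End | Pos_End

fun time_of :: "'a squeezed \<Rightarrow> ereal" where
  "time_of (Pt x t) = ereal t"
| "time_of Neg_End = -\<infinity>"
| "time_of Pos_End = \<infinity>"

text \<open>The two end points have no spatial position; the value there is arbitrary.\<close>

fun pos_of :: "'a squeezed \<Rightarrow> 'a" where
  "pos_of (Pt x t) = x"
| "pos_of Neg_End = undefined"
| "pos_of Pos_End = undefined"

text \<open>
  If \<^term>\<open>p\<close> is a finite point, then the convergence of times forces \<^term>\<open>z n\<close> to be a finite
  point for all large \<^term>\<open>n\<close>, so the arbitrary values of \<^const>\<open>pos_of\<close> play no role.
\<close>

definition squeezed_converges :: "(nat \<Rightarrow> 'a::metric_space squeezed) \<Rightarrow> 'a squeezed \<Rightarrow> bool" where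
  "squeezed_converges z p \<longleftrightarrow>
     (\<lambda>n. time_of (z n)) \<longlonglongrightarrow> time_of p \<and>
     (time_of p \<in> range ereal \<longrightarrow> (\<lambda>n. pos_of (z n)) \<longlonglongrightarrow> pos_of p)"

text \<open>
  A metrisable topology is determined by its convergent sequences: its open sets are the
  sequentially open ones. Lemmas \<open>mtopology_squeezed_dist\<close> and \<open>tendsto_squeezed_iff\<close> below show that
  the topology defined here is indeed metrisable and has exactly the prescribed convergent sequences.
\<close>

instantiation squeezed :: (metric_space) topological_space
begin

definition open_squeezed :: "'a squeezed set \<Rightarrow> bool" where
  "open_squeezed U \<longleftrightarrow>
     (\<forall>z p. p \<in> U \<longrightarrow> squeezed_converges z p \<longrightarrow> (\<forall>\<^sub>F n in sequentially. z n \<in> U))"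

instance
proof
  show "open (UNIV :: 'a squeezed set)"
    by (simp add: open_squeezed_def)
  show "open (S \<inter> T)" if "open S" "open T" for S T :: "'a squeezed set"
    using that unfolding open_squeezed_def by (auto simp: eventually_conj_iff)
  show "open (\<Union>K)" if "\<forall>S\<in>K. open S" for K :: "'a squeezed set set"
    unfolding open_squeezed_def
  proof (intro allI impI)
    fix z p assume "p \<in> \<Union>K" and z: "squeezed_converges z p"
    then obtain S where S: "S \<in> K" "p \<in> S" by blast
    with that z have "\<forall>\<^sub>F n in sequentially. z n \<in> S"
      unfolding open_squeezed_def by blast
    then show "\<forall>\<^sub>F n in sequentially. z n \<in> \<Union>K"
      by (rule eventually_mono) (use S in blast)
  qed
qed

end


section \<open>Paths\<close>

text \<open>
  A path is a pair of its graph and the total order on the graph, as a set of pairs. Its one-sided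
  limits, given by \<open>path_lims\<close> below, are meaningful only at the times in \<open>path_times\<close>.
\<close>

type_synonym 'a opath = "'a squeezed set \<times> 'a squeezed rel"

definition Path_space :: "'a::metric_space opath set" where
  "Path_space = {(P, R).
     P \<noteq> {} \<and> compact P \<and> linear_order_on P R \<and>
     closedin (top_of_set (P \<times> P)) R \<and>
     (\<forall>z\<in>P. \<forall>z'\<in>P. time_of z < time_of z' \<longrightarrow> (z, z') \<in> R) \<and>
     (\<forall>t. finite {x. Pt x t \<in> P} \<and> card {x. Pt x t \<in> P} \<le> 2)}"

definition path_times :: "'a opath \<Rightarrow> real set" where
  "path_times p = {t. \<exists>x. Pt x t \<in> fst p}"

definition path_lims :: "'a opath \<Rightarrow> real \<Rightarrow> 'a \<times> 'a" where
  "path_lims p t =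
     (THE (x, y). {x. Pt x t \<in> fst p} = {x, y} \<and> (Pt x t, Pt y t) \<in> snd p)"

definition path_left :: "'a opath \<Rightarrow> real \<Rightarrow> 'a" where
  "path_left p t = fst (path_lims p t)"

definition path_right :: "'a opath \<Rightarrow> real \<Rightarrow> 'a" where
  "path_right p t = snd (path_lims p t)"

definition Cpath_space :: "'a::metric_space opath set" where
  "Cpath_space = {p \<in> Path_space. \<forall>t\<in>path_times p. path_left p t = path_right p t}"

text \<open>Only used for continuous paths, where left and right limits agree.\<close>

abbreviation path_at :: "'a opath \<Rightarrow> real \<Rightarrow> 'a" where
  "path_at \<equiv> path_left"


section \<open>The topology of the space of continuous paths\<close>

text \<open>
  The value is set to 0 when the two one-sided suprema or infima below need not exist. This does not
  concern nonempty compact sets, and makes the function symmetric and nonnegative for all arguments,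
  as \<^locale>\<open>Metric_space\<close> demands.
\<close>

definition hausdorff_dist :: "('b \<Rightarrow> 'b \<Rightarrow> real) \<Rightarrow> 'b set \<Rightarrow> 'b set \<Rightarrow> real" where
  "hausdorff_dist D A B =
     (if A \<noteq> {} \<and> B \<noteq> {} \<and> bdd_above ((\<lambda>(a, b). D a b) ` (A \<times> B))
      then max (SUP a\<in>A. INF b\<in>B. D a b) (SUP b\<in>B. INF a\<in>A. D a b)
      else 0)"

definition path_dist ::
  "('a squeezed \<Rightarrow> 'a squeezed \<Rightarrow> real) \<Rightarrow> 'a opath \<Rightarrow> 'a opath \<Rightarrow> real" where
  "path_dist D p q = hausdorff_dist D (fst p) (fst q)"

text \<open>
  \<^term>\<open>D\<close> stands for any metric that generates the topology of the squeezed space. See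
  \<open>Metric_space_Cpath\<close> below for the metric axioms, which rely on the order of a continuous path
  being determined by its graph.
\<close>

definition Cpath_topology ::
  "('a::metric_space squeezed \<Rightarrow> 'a squeezed \<Rightarrow> real) \<Rightarrow> 'a opath topology" where
  "Cpath_topology D = Metric_space.mtopology Cpath_space (path_dist D)"


section \<open>Compact containment and equicontinuity\<close>

definition compact_containment :: "'a::metric_space opath set \<Rightarrow> bool" where
  "compact_containment A \<longleftrightarrow>
     (\<forall>T. \<exists>C. compact C \<and> (\<forall>p\<in>A. \<forall>t\<in>path_times p \<inter> {-T..T}. path_at p t \<in> C))"

text \<open>
  Suprema are taken in \<^typ>\<open>ennreal\<close>, where the supremum of the empty set is 0 and unbounded sets
  have supremum \<open>\<infinity>\<close>.
\<close>

definition modulus :: "real \<Rightarrow> real \<Rightarrow> 'a::metric_space opath \<Rightarrow> ennreal" where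
  "modulus T \<delta> p =
     Sup {ennreal (dist (path_at p t1) (path_at p t2)) | t1 t2.
            t1 \<in> path_times p \<and> t2 \<in> path_times p \<and>
            -T \<le> t1 \<and> t1 < t2 \<and> t2 \<le> T \<and> t2 - t1 \<le> \<delta>}"

definition path_equicontinuous :: "'a::metric_space opath set \<Rightarrow> bool" where
  "path_equicontinuous A \<longleftrightarrow>
     (\<forall>T>0. ((\<lambda>\<delta>. SUP p\<in>A. modulus T \<delta> p) \<longlongrightarrow> 0) (at_right 0))"


section \<open>A metric for the squeezed space\<close>

definition squash :: "ereal \<Rightarrow> real" where
  "squash a = (case a of ereal t \<Rightarrow> t / (1 + \<bar>t\<bar>) | PInfty \<Rightarrow> 1 | MInfty \<Rightarrow> -1)"

lemma squash_simps [simp]: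
  "squash (ereal t) = t / (1 + \<bar>t\<bar>)" "squash \<infinity> = 1" "squash (-\<infinity>) = -1"
  by (simp_all add: squash_def)

lemma squash_real_less: "s / (1 + \<bar>s\<bar>) < t / (1 + \<bar>t\<bar>)" if "s < t" for s t :: real
proof -
  have p: "0 < 1 + \<bar>s\<bar>" "0 < 1 + \<bar>t\<bar>" by auto
  have "s * (1 + \<bar>t\<bar>) < t * (1 + \<bar>s\<bar>)"
  proof (cases "0 \<le> s \<or> t \<le> 0")
    case True
    then have "s * \<bar>t\<bar> = t * \<bar>s\<bar>" using that by (auto simp: abs_if)
    then show ?thesis using that by (simp add: algebra_simps)
  next
    case False
    then have "s * (1 + \<bar>t\<bar>) < 0" "0 < t * (1 + \<bar>s\<bar>)" using p by (auto simp: mult_neg_pos)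
    then show ?thesis by linarith
  qed
  then show ?thesis using p by (simp add: divide_simps mult.commute)
qed

lemma squash_real_bounds: "-1 < t / (1 + \<bar>t\<bar>)" "t / (1 + \<bar>t\<bar>) < 1" for t :: real
  by (auto simp: divide_simps abs_if)

lemma squash_less: "a < b \<Longrightarrow> squash a < squash b"
  by (cases a; cases b) (auto simp: squash_real_less squash_real_bounds)

lemma squash_less_iff: "squash a < squash b \<longleftrightarrow> a < b"
  by (metis linorder_less_linear squash_less order_less_asym)

lemma squash_eq_iff: "squash a = squash b \<longleftrightarrow> a = b"
  by (metis linorder_less_linear squash_less order_less_irrefl)

lemma squash_bounds: "\<bar>squash a\<bar> \<le> 1"
proof (cases a)
  case (real r)
  then show ?thesis using squash_real_bounds[of r] by auto
qed auto

lemma squash_surj: "\<exists>a. squash a = u" if "-1 < u" "u < 1"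
proof (rule exI)
  show "squash (ereal (u / (1 - \<bar>u\<bar>))) = u"
    using that by (auto simp: divide_simps abs_if split: if_splits)
qed

lemma tendsto_squash_iff: "((\<lambda>n. squash (f n)) \<longlongrightarrow> squash l) F \<longleftrightarrow> (f \<longlongrightarrow> l) F"
proof
  assume L: "((\<lambda>n. squash (f n)) \<longlongrightarrow> squash l) F"
  show "(f \<longlongrightarrow> l) F"
  proof (rule order_tendstoI)
    show "\<forall>\<^sub>F n in F. a < f n" if "a < l" for a
      using order_tendstoD(1)[OF L squash_less[OF that]] by (simp add: squash_less_iff)
    show "\<forall>\<^sub>F n in F. f n < a" if "l < a" for a
      using order_tendstoD(2)[OF L squash_less[OF that]] by (simp add: squash_less_iff)
  qed
next
  assume L: "(f \<longlongrightarrow> l) F"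
  show "((\<lambda>n. squash (f n)) \<longlongrightarrow> squash l) F"
  proof (rule order_tendstoI)
    fix u assume u: "u < squash l"
    show "\<forall>\<^sub>F n in F. u < squash (f n)"
    proof (cases "-1 < u")
      case True
      have "u < 1" using u squash_bounds[of l] by linarith
      then obtain a where "squash a = u" using squash_surj True by blast
      then show ?thesis using L[THEN order_tendstoD(1)] u by (auto simp: squash_less_iff)
    next
      case False
      have *: "u < squash b" if "-\<infinity> < b" for b
        using squash_less[OF that] False by auto
      show ?thesis
      proof (cases "u = -1")
        case True
        then have "-\<infinity> < l" using u by (cases l) auto
        then have "\<forall>\<^sub>F n in F. -\<infinity> < f n" using order_tendstoD(1)[OF L] by blast
        then show ?thesis by (rule eventually_mono) (use * in blast)
      next
        case neq: False
        have "u < squash b" for b using False neq squash_bounds[of b] by linarith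
        then show ?thesis by simp
      qed
    qed
  next
    fix u assume u: "squash l < u"
    show "\<forall>\<^sub>F n in F. squash (f n) < u"
    proof (cases "u < 1")
      case True
      have "-1 < u" using u squash_bounds[of l] by linarith
      then obtain a where "squash a = u" using squash_surj True by blast
      then show ?thesis using L[THEN order_tendstoD(2)] u by (auto simp: squash_less_iff)
    next
      case False
      have *: "squash b < u" if "b < \<infinity>" for b
        using squash_less[OF that] False by auto
      show ?thesis
      proof (cases "u = 1")
        case True
        then have "l < \<infinity>" using u by (cases l) auto
        then have "\<forall>\<^sub>F n in F. f n < \<infinity>" using order_tendstoD(2)[OF L] by blast
        then show ?thesis by (rule eventually_mono) (use * in blast)
      next
        case neq: False
        have "squash b < u" for b using False neq squash_bounds[of b] by linarith
        then show ?thesis by simp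
      qed
    qed
  qed
qed

definition squeezed_dist :: "'a::metric_space squeezed \<Rightarrow> 'a squeezed \<Rightarrow> real" where
  "squeezed_dist z w =
     min (1 - \<bar>squash (time_of z)\<bar>) (1 - \<bar>squash (time_of w)\<bar>) * min 1 (dist (pos_of z) (pos_of w))
     + \<bar>squash (time_of z) - squash (time_of w)\<bar>"

lemma squash_time_Pt: "\<bar>squash (time_of (Pt x t))\<bar> < 1"
  using squash_real_bounds[of t] by auto

lemma Metric_space_squeezed_dist: "Metric_space UNIV (squeezed_dist :: 'a::metric_space squeezed \<Rightarrow> _)"
proof
  fix x y z :: "'a squeezed"
  show "0 \<le> squeezed_dist x y"
    unfolding squeezed_dist_def
    using squash_bounds[of "time_of x"] squash_bounds[of "time_of y"]
    by (intro add_nonneg_nonneg mult_nonneg_nonneg) auto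
  show "squeezed_dist x y = squeezed_dist y x"
    unfolding squeezed_dist_def by (simp add: dist_commute min.commute abs_minus_commute)
  show "squeezed_dist x y = 0 \<longleftrightarrow> x = y"
  proof
    assume 0: "squeezed_dist x y = 0"
    let ?m = "min (1 - \<bar>squash (time_of x)\<bar>) (1 - \<bar>squash (time_of y)\<bar>) * min 1 (dist (pos_of x) (pos_of y))"
    have m: "0 \<le> ?m"
      using squash_bounds[of "time_of x"] squash_bounds[of "time_of y"]
      by (intro mult_nonneg_nonneg) auto
    have "squash (time_of x) = squash (time_of y)" and m0: "?m = 0"
      using 0 m unfolding squeezed_dist_def by linarith+
    then have t: "time_of x = time_of y" by (simp add: squash_eq_iff)
    show "x = y"
    proof (cases x)
      case (Pt u s)
      with t obtain v where y: "y = Pt v s" by (cases y) auto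
      have "min 1 (dist u v) = 0"
        using m0 squash_time_Pt[of u s] Pt y by auto
      then show ?thesis using Pt y by (auto simp: min_def split: if_splits)
    qed (use t in \<open>cases y; auto\<close>)+
  qed (simp add: squeezed_dist_def)
  show "squeezed_dist x z \<le> squeezed_dist x y + squeezed_dist y z"
  proof -
    define a b c where "a = squash (time_of x)" "b = squash (time_of y)" "c = squash (time_of z)"
    define p q r where "p = min 1 (dist (pos_of x) (pos_of y))"
      "q = min 1 (dist (pos_of y) (pos_of z))" "r = min 1 (dist (pos_of x) (pos_of z))"
    have ab: "\<bar>a\<bar> \<le> 1" "\<bar>b\<bar> \<le> 1" "\<bar>c\<bar> \<le> 1" using squash_bounds by (auto simp: a_b_c_def)
    have pq: "0 \<le> p" "0 \<le> q" "0 \<le> r" "r \<le> 1" by (auto simp: p_q_r_def)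
    have "r \<le> p + q"
      using dist_triangle[of "pos_of x" "pos_of z" "pos_of y"]
        zero_le_dist[of "pos_of x" "pos_of y"] zero_le_dist[of "pos_of y" "pos_of z"]
      unfolding p_q_r_def by linarith
    define m where "m = min (1 - \<bar>a\<bar>) (1 - \<bar>c\<bar>)"
    have m0: "0 \<le> m" using ab by (auto simp: m_def)
    have "m * r + \<bar>a - c\<bar> \<le> (min (1 - \<bar>a\<bar>) (1 - \<bar>b\<bar>) * p + \<bar>a - b\<bar>) + (min (1 - \<bar>b\<bar>) (1 - \<bar>c\<bar>) * q + \<bar>b - c\<bar>)"
    proof (cases "m \<le> 1 - \<bar>b\<bar>")
      case True
      have "m * r \<le> m * p + m * q"
        using mult_left_mono[OF \<open>r \<le> p + q\<close> m0] by (simp add: algebra_simps)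
      moreover have "m * p \<le> min (1 - \<bar>a\<bar>) (1 - \<bar>b\<bar>) * p"
        by (rule mult_right_mono) (use True pq in \<open>auto simp: m_def\<close>)
      moreover have "m * q \<le> min (1 - \<bar>b\<bar>) (1 - \<bar>c\<bar>) * q"
        by (rule mult_right_mono) (use True pq in \<open>auto simp: m_def\<close>)
      moreover have "R + u \<le> (P' + v) + (Q' + w)"
        if "R \<le> P + Q" "P \<le> P'" "Q \<le> Q'" "u \<le> v + w" for P Q R P' Q' u v w :: real
        using that by linarith
      moreover have "\<bar>a - c\<bar> \<le> \<bar>a - b\<bar> + \<bar>b - c\<bar>" by linarith
      ultimately show ?thesis by blast
    next
      case False
      define k where "k = 1 - \<bar>b\<bar>"
      have k: "min (1 - \<bar>a\<bar>) (1 - \<bar>b\<bar>) = k" "min (1 - \<bar>b\<bar>) (1 - \<bar>c\<bar>) = k"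
        using False by (auto simp: m_def k_def)
      have "k * r \<le> k * p + k * q"
        using mult_left_mono[OF \<open>r \<le> p + q\<close>, of k] ab by (simp add: algebra_simps k_def)
      moreover have "(m - k) * r \<le> m - k"
        using mult_left_mono[OF \<open>r \<le> 1\<close>, of "m - k"] False by (simp add: k_def)
      moreover have "\<bar>a - c\<bar> + (m - k) \<le> \<bar>a - b\<bar> + \<bar>b - c\<bar>"
        using False unfolding m_def k_def by linarith
      moreover have "m * r + u \<le> (k * p + v) + (k * q + w)"
        if "k * r \<le> k * p + k * q" "(m - k) * r \<le> m - k" "u + (m - k) \<le> v + w" for u v w :: real
        using that by (simp add: algebra_simps)
      ultimately show ?thesis unfolding k by blast
    qed
    then show ?thesis unfolding squeezed_dist_def m_def a_b_c_def p_q_r_def .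
  qed
qed

lemma squeezed_dist_tendsto_iff:
  "(\<lambda>n. squeezed_dist (z n) p) \<longlonglongrightarrow> 0 \<longleftrightarrow> squeezed_converges z p"
proof -
  define \<tau> where "\<tau> n = squash (time_of (z n))" for n
  define \<theta> where "\<theta> = squash (time_of p)"
  define \<mu> where "\<mu> n = min (1 - \<bar>\<tau> n\<bar>) (1 - \<bar>\<theta>\<bar>)" for n
  define \<rho> where "\<rho> n = min 1 (dist (pos_of (z n)) (pos_of p))" for n
  have D: "squeezed_dist (z n) p = \<mu> n * \<rho> n + \<bar>\<tau> n - \<theta>\<bar>" for n
    by (simp add: squeezed_dist_def \<mu>_def \<rho>_def \<tau>_def \<theta>_def)
  have \<mu>: "0 \<le> \<mu> n" and \<rho>: "0 \<le> \<rho> n" "\<rho> n \<le> 1" for n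
    using squash_bounds by (auto simp: \<mu>_def \<rho>_def \<tau>_def \<theta>_def)
  have \<mu>\<rho>: "0 \<le> \<mu> n * \<rho> n" for n using \<mu> \<rho> by simp
  have \<tau>: "\<tau> \<longlonglongrightarrow> \<theta> \<longleftrightarrow> (\<lambda>n. time_of (z n)) \<longlonglongrightarrow> time_of p"
    unfolding \<tau>_def \<theta>_def by (rule tendsto_squash_iff)
  have \<mu>lim: "\<mu> \<longlonglongrightarrow> 1 - \<bar>\<theta>\<bar>" if "\<tau> \<longlonglongrightarrow> \<theta>"
  proof -
    have "\<mu> \<longlonglongrightarrow> min (1 - \<bar>\<theta>\<bar>) (1 - \<bar>\<theta>\<bar>)"
      unfolding \<mu>_def by (intro tendsto_intros that)
    then show ?thesis by simp
  qed
  have \<rho>iff: "\<rho> \<longlonglongrightarrow> 0 \<longleftrightarrow> (\<lambda>n. pos_of (z n)) \<longlonglongrightarrow> pos_of p"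
  proof
    assume R: "\<rho> \<longlonglongrightarrow> 0"
    show "(\<lambda>n. pos_of (z n)) \<longlonglongrightarrow> pos_of p"
    proof (rule tendstoI)
      fix e :: real assume "0 < e"
      then have "\<forall>\<^sub>F n in sequentially. \<rho> n < min 1 e" using order_tendstoD(2)[OF R, of "min 1 e"] by simp
      then show "\<forall>\<^sub>F n in sequentially. dist (pos_of (z n)) (pos_of p) < e"
        by (rule eventually_mono) (auto simp: \<rho>_def min_def split: if_splits)
    qed
  next
    assume "(\<lambda>n. pos_of (z n)) \<longlonglongrightarrow> pos_of p"
    then have "(\<lambda>n. dist (pos_of (z n)) (pos_of p)) \<longlonglongrightarrow> 0" by (rule tendsto_dist_iff[THEN iffD1])
    then have "\<rho> \<longlonglongrightarrow> min 1 0" unfolding \<rho>_def by (rule tendsto_min[OF tendsto_const])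
    then show "\<rho> \<longlonglongrightarrow> 0" by simp
  qed
  have fin: "0 < 1 - \<bar>\<theta>\<bar> \<longleftrightarrow> time_of p \<in> range ereal"
  proof (cases p)
    case (Pt x t)
    then show ?thesis using squash_time_Pt[of x t] by (simp add: \<theta>_def del: squash_simps)
  qed (auto simp: \<theta>_def)
  show ?thesis
  proof
    assume L: "(\<lambda>n. squeezed_dist (z n) p) \<longlonglongrightarrow> 0"
    have "(\<lambda>n. \<bar>\<tau> n - \<theta>\<bar>) \<longlonglongrightarrow> 0"
      by (rule tendsto_sandwich[OF _ _ tendsto_const L]) (auto simp: D \<mu>\<rho>)
    then have T: "\<tau> \<longlonglongrightarrow> \<theta>" using LIM_zero_cancel tendsto_rabs_zero_iff by blast
    moreover have "\<rho> \<longlonglongrightarrow> 0" if "0 < 1 - \<bar>\<theta>\<bar>"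
    proof -
      have "(\<lambda>n. \<mu> n * \<rho> n) \<longlonglongrightarrow> 0"
        by (rule tendsto_sandwich[OF _ _ tendsto_const L]) (auto simp: D \<mu>\<rho>)
      then have "(\<lambda>n. \<mu> n * \<rho> n / \<mu> n) \<longlonglongrightarrow> 0 / (1 - \<bar>\<theta>\<bar>)"
        using \<mu>lim[OF T] that by (intro tendsto_divide) auto
      moreover have "\<forall>\<^sub>F n in sequentially. 0 < \<mu> n"
        using \<mu>lim[OF T] that order_tendstoD(1) by blast
      then have "\<forall>\<^sub>F n in sequentially. \<mu> n * \<rho> n / \<mu> n = \<rho> n"
        by (rule eventually_mono) auto
      ultimately show ?thesis by (simp add: tendsto_cong)
    qed
    ultimately show "squeezed_converges z p"
      unfolding squeezed_converges_def using \<tau> \<rho>iff fin by blast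
  next
    assume R: "squeezed_converges z p"
    then have T: "\<tau> \<longlonglongrightarrow> \<theta>" unfolding squeezed_converges_def using \<tau> by blast
    then have T0: "(\<lambda>n. \<bar>\<tau> n - \<theta>\<bar>) \<longlonglongrightarrow> 0" by (simp add: LIM_zero tendsto_rabs_zero)
    have "(\<lambda>n. \<mu> n * \<rho> n) \<longlonglongrightarrow> 0"
    proof (cases "0 < 1 - \<bar>\<theta>\<bar>")
      case True
      then have "\<rho> \<longlonglongrightarrow> 0" using R fin \<rho>iff unfolding squeezed_converges_def by blast
      then have "(\<lambda>n. \<mu> n * \<rho> n) \<longlonglongrightarrow> (1 - \<bar>\<theta>\<bar>) * 0" by (intro tendsto_mult \<mu>lim T)
      then show ?thesis by simp
    next
      case False
      then have "1 - \<bar>\<theta>\<bar> = 0" using squash_bounds[of "time_of p"] by (auto simp: \<theta>_def)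
      then have M: "\<mu> \<longlonglongrightarrow> 0" using \<mu>lim[OF T] by simp
      have "\<mu> n * \<rho> n \<le> \<mu> n" for n using mult_left_mono[OF \<rho>(2) \<mu>] by simp
      then show ?thesis
        by (intro tendsto_sandwich[OF _ _ tendsto_const M]) (auto simp: \<mu>\<rho>)
    qed
    then have "(\<lambda>n. \<mu> n * \<rho> n + \<bar>\<tau> n - \<theta>\<bar>) \<longlonglongrightarrow> 0 + 0" using T0 by (rule tendsto_add)
    then show "(\<lambda>n. squeezed_dist (z n) p) \<longlonglongrightarrow> 0" by (simp add: D)
  qed
qed

lemma limitin_squeezed_dist_iff:
  "limitin (Metric_space.mtopology UNIV squeezed_dist) z p sequentially \<longleftrightarrow> squeezed_converges z p"
  by (simp add: Metric_space.limitin_metric_dist_null[OF Metric_space_squeezed_dist]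
        squeezed_dist_tendsto_iff)

lemma mtopology_squeezed_dist:
  "Metric_space.mtopology UNIV squeezed_dist = (euclidean :: 'a::metric_space squeezed topology)"
proof -
  interpret S: Metric_space UNIV "squeezed_dist :: 'a squeezed \<Rightarrow> _"
    by (rule Metric_space_squeezed_dist)
  have "openin S.mtopology U \<longleftrightarrow> open U" for U
  proof
    assume "openin S.mtopology U"
    then show "open U"
      unfolding open_squeezed_def limitin_squeezed_dist_iff[symmetric] limitin_def by blast
  next
    assume U: "open U"
    have "closedin S.mtopology (- U)"
      unfolding S.metric_closedin_iff_sequentially_closed limitin_squeezed_dist_iff
    proof (intro conjI allI impI)
      fix \<sigma> l assume \<sigma>: "range \<sigma> \<subseteq> - U \<and> squeezed_converges \<sigma> l"
      show "l \<in> - U"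
      proof
        assume "l \<in> U"
        then have "\<forall>\<^sub>F n in sequentially. \<sigma> n \<in> U" using U \<sigma> unfolding open_squeezed_def by blast
        then obtain n where "\<sigma> n \<in> U" using eventually_happens' sequentially_bot by blast
        with \<sigma> show False by blast
      qed
    qed simp
    then show "openin S.mtopology U" by (simp add: closedin_def Compl_eq_Diff_UNIV Diff_Diff_Int)
  qed
  then show ?thesis by (simp add: topology_eq)
qed

lemma tendsto_squeezed_iff: "z \<longlonglongrightarrow> p \<longleftrightarrow> squeezed_converges z p"
  for p :: "'a::metric_space squeezed"
  using limitin_squeezed_dist_iff[of z p] by (simp add: mtopology_squeezed_dist)


section \<open>The Hausdorff metric on continuous paths\<close>

lemma Cpath_unique:
  assumes p: "p \<in> Cpath_space" and z: "z \<in> fst p" "z' \<in> fst p" "time_of z = time_of z'"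
  shows "z = z'"
proof (cases z)
  case (Pt x t)
  with z obtain y where y: "z' = Pt y t" by (cases z') auto
  obtain P R where pPR: "p = (P, R)" by (cases p)
  from p have R: "linear_order_on P R" and fin: "finite {x. Pt x t \<in> P}"
    and card: "card {x. Pt x t \<in> P} \<le> 2"
    by (auto simp: Cpath_space_def Path_space_def pPR)
  have t: "t \<in> path_times p" using z Pt by (auto simp: path_times_def)
  let ?S = "{x. Pt x t \<in> P}"
  let ?Q = "\<lambda>(u, v). ?S = {u, v} \<and> (Pt u t, Pt v t) \<in> R"
  have xy: "x \<in> ?S" "y \<in> ?S" using z Pt y pPR by auto
  show ?thesis
  proof (rule ccontr)
    assume "z \<noteq> z'"
    then have "x \<noteq> y" using Pt y by auto
    then have "card {x, y} = 2" by simp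
    then have S: "?S = {x, y}"
      using card_subset_eq[OF fin, of "{x, y}"] card card_mono[OF fin, of "{x, y}"] xy by auto
    have "Pt x t \<in> P" "Pt y t \<in> P" "Pt x t \<noteq> Pt y t" using xy \<open>x \<noteq> y\<close> by auto
    then have tot: "(Pt x t, Pt y t) \<in> R \<or> (Pt y t, Pt x t) \<in> R"
      using R unfolding linear_order_on_def total_on_def by blast
    have anti: "antisym R" using R by (simp add: linear_order_on_def partial_order_on_def)
    have "\<exists>!uv. ?Q uv"
    proof (rule ex_ex1I)
      have "?Q (x, y) \<or> ?Q (y, x)"
        unfolding S prod.case insert_commute[of y x] using tot by blast
      then show "\<exists>uv. ?Q uv" by blast
    next
      fix a b assume ab: "?Q a" "?Q b"
      obtain a1 a2 b1 b2 where e: "a = (a1, a2)" "b = (b1, b2)" by (cases a, cases b)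
      have ab': "{x, y} = {a1, a2}" "(Pt a1 t, Pt a2 t) \<in> R"
        "{x, y} = {b1, b2}" "(Pt b1 t, Pt b2 t) \<in> R"
        using ab unfolding e prod.case S by blast+
      have "\<not> ((Pt x t, Pt y t) \<in> R \<and> (Pt y t, Pt x t) \<in> R)"
        using anti \<open>Pt x t \<noteq> Pt y t\<close> by (meson antisymD)
      then show "a = b" unfolding e using ab' by (auto simp: doubleton_eq_iff)
    qed
    then have Q: "?Q (path_lims p t)"
      unfolding path_lims_def pPR fst_conv snd_conv by (rule theI')
    moreover have "path_left p t = path_right p t" using p t by (auto simp: Cpath_space_def)
    ultimately have "\<exists>u. ?S = {u}"
      unfolding path_left_def path_right_def by (cases "path_lims p t") auto
    then show False using S \<open>x \<noteq> y\<close> by auto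
  qed
qed (use z in \<open>cases z'; auto\<close>)+

lemma Cpath_order_determined:
  assumes "p \<in> Cpath_space"
  shows "snd p = {(z, z'). z \<in> fst p \<and> z' \<in> fst p \<and> time_of z \<le> time_of z'}"
proof -
  obtain P R where pPR: "p = (P, R)" by (cases p)
  from assms have lin: "linear_order_on P R"
    and ii: "\<And>z z'. z \<in> P \<Longrightarrow> z' \<in> P \<Longrightarrow> time_of z < time_of z' \<Longrightarrow> (z, z') \<in> R"
    by (auto simp: Cpath_space_def Path_space_def pPR)
  then have sub: "R \<subseteq> P \<times> P" and refl: "\<And>z. z \<in> P \<Longrightarrow> (z, z) \<in> R" and anti: "antisym R"
    by (auto simp: linear_order_on_def partial_order_on_def preorder_on_def refl_on_def)
  have uniq: "\<And>z z'. z \<in> P \<Longrightarrow> z' \<in> P \<Longrightarrow> time_of z = time_of z' \<Longrightarrow> z = z'"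
    using Cpath_unique[OF assms] by (simp add: pPR)
  have "(z, z') \<in> R \<longleftrightarrow> z \<in> P \<and> z' \<in> P \<and> time_of z \<le> time_of z'" for z z'
  proof
    assume zz: "(z, z') \<in> R"
    then have P: "z \<in> P" "z' \<in> P" using sub by auto
    moreover have "time_of z \<le> time_of z'"
    proof (rule ccontr)
      assume "\<not> time_of z \<le> time_of z'"
      then have l: "time_of z' < time_of z" by simp
      then have "(z', z) \<in> R" using ii P by blast
      then have "z = z'" using anti zz by (auto dest: antisymD)
      then show False using l by simp
    qed
    ultimately show "z \<in> P \<and> z' \<in> P \<and> time_of z \<le> time_of z'" by blast
  next
    assume "z \<in> P \<and> z' \<in> P \<and> time_of z \<le> time_of z'"
    then show "(z, z') \<in> R" using ii uniq refl by (metis order_le_less)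
  qed
  then show ?thesis unfolding pPR by auto
qed

lemma (in Metric_space) hausdorff_dist_nonneg:
  "0 \<le> hausdorff_dist d A B"
proof (cases "A \<noteq> {} \<and> B \<noteq> {} \<and> bdd_above ((\<lambda>(a, b). d a b) ` (A \<times> B))")
  case True
  then obtain K where K: "\<And>a b. a \<in> A \<Longrightarrow> b \<in> B \<Longrightarrow> d a b \<le> K"
    unfolding bdd_above_def by fastforce
  from True obtain a b where ab: "a \<in> A" "b \<in> B" by blast
  have "(INF b\<in>B. d x b) \<le> K" if "x \<in> A" for x
    using K[OF that ab(2)] ab(2) by (intro cINF_lower2) (auto intro: bdd_belowI2[where m=0])
  then have "(INF b\<in>B. d a b) \<le> (SUP a\<in>A. INF b\<in>B. d a b)"
    by (intro cSUP_upper ab(1) bdd_aboveI2)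
  moreover have "0 \<le> (INF b\<in>B. d a b)" using ab by (intro cINF_greatest) auto
  ultimately show ?thesis unfolding hausdorff_dist_def using True by auto
qed (simp only: hausdorff_dist_def if_False order_refl)

lemma (in Metric_space) hausdorff_dist_commute:
  "hausdorff_dist d A B = hausdorff_dist d B A"
proof -
  have "(\<lambda>(a, b). d a b) ` (A \<times> B) = (\<lambda>(a, b). d a b) ` (B \<times> A)"
    by (force simp: commute image_iff)
  moreover have "(INF b\<in>B. d a b) = (INF b\<in>B. d b a)" "(INF b\<in>A. d a b) = (INF b\<in>A. d b a)" for a
    by (simp_all add: commute)
  ultimately show ?thesis unfolding hausdorff_dist_def by (auto simp: max.commute)
qed

lemma (in Metric_space) hausdorff_dist_compact:
  assumes "compactin mtopology A" "compactin mtopology B" "A \<noteq> {}" "B \<noteq> {}"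
  shows "hausdorff_dist d A B = max (SUP a\<in>A. INF b\<in>B. d a b) (SUP b\<in>B. INF a\<in>A. d a b)"
    and "a \<in> A \<Longrightarrow> (INF b\<in>B. d a b) \<le> hausdorff_dist d A B"
    and "b \<in> B \<Longrightarrow> (INF a\<in>A. d a b) \<le> hausdorff_dist d A B"
proof -
  have "mbounded (A \<union> B)" using assms by (simp add: compactin_imp_mbounded mbounded_Un)
  then obtain K where K: "\<And>a b. a \<in> A \<Longrightarrow> b \<in> B \<Longrightarrow> d a b \<le> K"
    unfolding mbounded_alt by blast
  then have "bdd_above ((\<lambda>(a, b). d a b) ` (A \<times> B))" unfolding bdd_above_def by auto
  then show H: "hausdorff_dist d A B = max (SUP a\<in>A. INF b\<in>B. d a b) (SUP b\<in>B. INF a\<in>A. d a b)"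
    using assms by (simp add: hausdorff_dist_def)
  obtain a0 b0 where ab: "a0 \<in> A" "b0 \<in> B" using assms by blast
  have 1: "(INF b\<in>B. d a b) \<le> K" if "a \<in> A" for a
    using K[OF that ab(2)] ab(2) by (intro cINF_lower2) (auto intro: bdd_belowI2[where m=0])
  have 2: "(INF a\<in>A. d a b) \<le> K" if "b \<in> B" for b
    using K[OF ab(1) that] ab(1) by (intro cINF_lower2) (auto intro: bdd_belowI2[where m=0])
  have "(INF b\<in>B. d a b) \<le> (SUP a\<in>A. INF b\<in>B. d a b)" if "a \<in> A"
    using 1 that by (intro cSUP_upper bdd_aboveI2)
  then show "a \<in> A \<Longrightarrow> (INF b\<in>B. d a b) \<le> hausdorff_dist d A B" unfolding H by simp
  have "(INF a\<in>A. d a b) \<le> (SUP b\<in>B. INF a\<in>A. d a b)" if "b \<in> B"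
    using 2 that by (intro cSUP_upper bdd_aboveI2)
  then show "b \<in> B \<Longrightarrow> (INF a\<in>A. d a b) \<le> hausdorff_dist d A B" unfolding H by simp
qed

lemma (in Metric_space) hausdorff_dist_triangle:
  assumes "compactin mtopology A" "compactin mtopology B" "compactin mtopology C"
    and ne: "A \<noteq> {}" "B \<noteq> {}" "C \<noteq> {}"
  shows "hausdorff_dist d A C \<le> hausdorff_dist d A B + hausdorff_dist d B C"
proof -
  have half: "(INF c\<in>Z. d x c) \<le> hausdorff_dist d X Y + hausdorff_dist d Y Z"
    if "compactin mtopology X" "compactin mtopology Y" "compactin mtopology Z"
      "Y \<noteq> {}" "Z \<noteq> {}" "x \<in> X" for X Y Z x
  proof -
    have ne': "X \<noteq> {}" using that by auto
    have M: "X \<subseteq> M" "Y \<subseteq> M" "Z \<subseteq> M" using that compactin_subset_topspace by fastforce+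
    have "(INF c\<in>Z. d x c) - hausdorff_dist d Y Z \<le> (INF y\<in>Y. d x y)"
    proof (rule cINF_greatest[OF that(4)])
      fix y assume y: "y \<in> Y"
      have "(INF c\<in>Z. d x c) - d x y \<le> (INF c\<in>Z. d y c)"
      proof (rule cINF_greatest[OF that(5)])
        fix c assume c: "c \<in> Z"
        have "(INF c\<in>Z. d x c) \<le> d x c"
          using c by (intro cINF_lower) (auto intro: bdd_belowI2[where m=0])
        also have "\<dots> \<le> d x y + d y c" using triangle M that y c by blast
        finally show "(INF c\<in>Z. d x c) - d x y \<le> d y c" by simp
      qed
      moreover have "(INF c\<in>Z. d y c) \<le> hausdorff_dist d Y Z"
        using hausdorff_dist_compact(2)[of Y Z y] that y by auto
      ultimately show "(INF c\<in>Z. d x c) - hausdorff_dist d Y Z \<le> d x y" by linarith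
    qed
    moreover have "(INF y\<in>Y. d x y) \<le> hausdorff_dist d X Y"
      using hausdorff_dist_compact(2)[of X Y x] that ne' by auto
    ultimately show ?thesis by linarith
  qed
  have "(SUP a\<in>A. INF c\<in>C. d a c) \<le> hausdorff_dist d A B + hausdorff_dist d B C"
    using half[of A B C] assms by (intro cSUP_least) auto
  moreover have "(SUP c\<in>C. INF a\<in>A. d a c) \<le> hausdorff_dist d A B + hausdorff_dist d B C"
  proof (rule cSUP_least[OF ne(3)])
    fix c assume "c \<in> C"
    then have "(INF a\<in>A. d c a) \<le> hausdorff_dist d C B + hausdorff_dist d B A"
      using half[of C B A c] assms by auto
    then show "(INF a\<in>A. d a c) \<le> hausdorff_dist d A B + hausdorff_dist d B C"
      by (simp add: commute hausdorff_dist_commute)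
  qed
  ultimately show ?thesis using hausdorff_dist_compact(1)[of A C] assms by simp
qed

lemma (in Metric_space) hausdorff_dist_zero:
  assumes "compactin mtopology A" "compactin mtopology B" "A \<noteq> {}" "B \<noteq> {}"
  shows "hausdorff_dist d A B = 0 \<longleftrightarrow> A = B"
proof -
  have sub: "X \<subseteq> Y" if "compactin mtopology X" "compactin mtopology Y"
      "X \<noteq> {}" "Y \<noteq> {}" "hausdorff_dist d X Y = 0" for X Y
  proof
    fix x assume x: "x \<in> X"
    have M: "X \<subseteq> M" "Y \<subseteq> M" using that compactin_subset_topspace by fastforce+
    have cl: "closedin mtopology Y"
      using that(2) Hausdorff_space_mtopology compactin_imp_closedin by blast
    have I: "(INF y\<in>Y. d x y) \<le> 0" using hausdorff_dist_compact(2)[of X Y x] that x by auto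
    show "x \<in> Y"
    proof (rule ccontr)
      assume "x \<notin> Y"
      then obtain r where r: "r > 0" "disjnt Y (mball x r)"
        using cl M x unfolding closedin_metric by blast
      have "r \<le> (INF y\<in>Y. d x y)"
      proof (rule cINF_greatest[OF that(4)])
        fix y assume "y \<in> Y"
        then have "y \<notin> mball x r" using r by (auto simp: disjnt_iff)
        then show "r \<le> d x y" using \<open>y \<in> Y\<close> M x by auto
      qed
      then show False using I r by linarith
    qed
  qed
  have "hausdorff_dist d A A = 0"
  proof -
    have M: "A \<subseteq> M" using assms compactin_subset_topspace by fastforce
    have "(INF b\<in>A. d a b) = 0" if "a \<in> A" for a
    proof (rule antisym)
      show "(INF b\<in>A. d a b) \<le> 0"
        using that M by (intro cINF_lower2[of _ _ a]) (auto intro: bdd_belowI2[where m=0])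
      show "0 \<le> (INF b\<in>A. d a b)" using that by (intro cINF_greatest) auto
    qed
    moreover have "(INF a\<in>A. d a b) = 0" if "b \<in> A" for b
    proof -
      have "(\<lambda>a. d a b) ` A = d b ` A" by (rule image_cong) (auto intro: commute)
      then show ?thesis using calculation[OF that] by metis
    qed
    ultimately show ?thesis using hausdorff_dist_compact(1)[of A A] assms by simp
  qed
  then show ?thesis using sub[of A B] sub[of B A] assms hausdorff_dist_commute by auto
qed

lemma Metric_space_Cpath:
  fixes D :: "'a::metric_space squeezed \<Rightarrow> 'a squeezed \<Rightarrow> real"
  assumes "Metric_space UNIV D" and top: "Metric_space.mtopology UNIV D = euclidean"
  shows "Metric_space Cpath_space (path_dist D)"
proof -
  interpret S: Metric_space UNIV D by fact
  have c: "compactin S.mtopology (fst p)" "fst p \<noteq> {}" if "p \<in> Cpath_space" for p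
    using that by (auto simp: top Cpath_space_def Path_space_def)
  show ?thesis
  proof
    fix p q r :: "'a opath"
    show "0 \<le> path_dist D p q" by (simp add: path_dist_def S.hausdorff_dist_nonneg)
    show "path_dist D p q = path_dist D q p" by (simp add: path_dist_def S.hausdorff_dist_commute)
    assume p: "p \<in> Cpath_space" and q: "q \<in> Cpath_space"
    have "fst p = fst q \<longleftrightarrow> p = q"
    proof
      assume eq: "fst p = fst q"
      have "snd p = snd q"
        unfolding Cpath_order_determined[OF p] Cpath_order_determined[OF q] eq ..
      with eq show "p = q" by (rule prod_eqI)
    qed simp
    then show "path_dist D p q = 0 \<longleftrightarrow> p = q"
      unfolding path_dist_def using S.hausdorff_dist_zero c[OF p] c[OF q] by blast
    assume r: "r \<in> Cpath_space"
    show "path_dist D p r \<le> path_dist D p q + path_dist D q r"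
      unfolding path_dist_def using S.hausdorff_dist_triangle c[OF p] c[OF q] c[OF r] by blast
  qed
qed

end

theory Submission
  imports Defs
begin

text \<open>
  All spaces involved are metrisable, so precompactness of \<open>A\<close> means that every sequence of paths
  in \<open>A\<close> has a subsequence whose graphs converge, in the Hausdorff metric, to the graph of some
  continuous path (\<open>compact_closure_of_sequentially\<close>).

  Suppose that \<open>A\<close> is equicontinuous and satisfies compact containment. The points of the graphs of
  all paths in \<open>A\<close> then form a precompact set of space-time points: the times of a sequence of points
  accumulate somewhere in the extended real line, and at a finite accumulation time the positions
  eventually lie in one compact set, while at \<open>\<plusminus>\<infinity>\<close> positions do not matter
  (\<open>squeezed_convergent_subsequence\<close>). Hence all graphs are subsets of one compact set, and by
  Blaschke's theorem (\<open>hausdorff_convergent_subsequence\<close>) any sequence of them has a subsequence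
  converging to a nonempty compact set \<open>L\<close>. What could go wrong is that \<open>L\<close> has two points at the same
  time. But two such points are limits of points of the same graphs whose times become arbitrarily
  close, so equicontinuity forces their positions to agree
  (\<open>equicontinuous_limit_position_unique\<close>). A nonempty compact set with at most one point at each
  time is the graph of a continuous path (\<open>Cpath_spaceI\<close>).

  Conversely, suppose that \<open>A\<close> is precompact. A sequence of points taken from paths in \<open>A\<close> has a
  subsequence that converges to a point of a limit path (\<open>hausdorff_limit_subsequence\<close>), which yields
  compact containment. If equicontinuity failed, two sequences of points on common paths would have
  asymptotically equal times in a bounded window but positions at distance greater than some \<open>e > 0\<close>;
  their limits would be two different points of a continuous path at the same time.
\<close>

section \<open>Precompactness and the Hausdorff metric\<close>

text \<open>
  Only sequences in \<open>S\<close> itself need to be tested, since every point of the closure is approximated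
  by points of \<open>S\<close>.
\<close>

lemma (in Metric_space) compact_closure_of_sequentially:
  assumes "S \<subseteq> M"
  shows "compactin mtopology (mtopology closure_of S) \<longleftrightarrow>
    (\<forall>\<sigma>::nat \<Rightarrow> 'a. range \<sigma> \<subseteq> S \<longrightarrow>
       (\<exists>l r. l \<in> M \<and> strict_mono r \<and> limitin mtopology (\<sigma> \<circ> r) l sequentially))"
proof -
  have M: "M \<inter> mtopology derived_set_of T = mtopology derived_set_of T" for T
    using derived_set_of_subset_topspace[of mtopology T] by auto
  show ?thesis
    unfolding compact_closure_of_eq_Bolzano_Weierstrass Bolzano_Weierstrass_property[OF assms assms]
    unfolding M using assms by (meson order_trans)
qed

lemma (in Metric_space) hausdorff_dist_less_imp_near:
  assumes "compactin mtopology A" "compactin mtopology B" "A \<noteq> {}" "B \<noteq> {}"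
    and "hausdorff_dist d A B < e" "a \<in> A"
  shows "\<exists>b\<in>B. d a b < e"
proof -
  have "(INF b\<in>B. d a b) < e"
    using hausdorff_dist_compact(2)[OF assms(1-4) assms(6)] assms(5) by linarith
  moreover have "bdd_below (d a ` B)" by (rule bdd_belowI2[where m=0]) simp
  ultimately show ?thesis using \<open>B \<noteq> {}\<close> by (simp add: cINF_less_iff)
qed

lemma (in Metric_space) hausdorff_dist_leI:
  assumes "compactin mtopology A" "compactin mtopology B" "A \<noteq> {}" "B \<noteq> {}"
    and AB: "\<And>a. a \<in> A \<Longrightarrow> \<exists>b\<in>B. d a b \<le> e"
    and BA: "\<And>b. b \<in> B \<Longrightarrow> \<exists>a\<in>A. d b a \<le> e"
  shows "hausdorff_dist d A B \<le> e"
proof -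
  have "(INF y\<in>Y. d x y) \<le> e" if "\<exists>y\<in>Y. d x y \<le> e" for x Y
    using that by (metis bdd_belowI2 cINF_lower2 nonneg)
  then have "(SUP a\<in>A. INF b\<in>B. d a b) \<le> e" "(SUP b\<in>B. INF a\<in>A. d b a) \<le> e"
    using AB BA assms(3,4) by (intro cSUP_least; blast)+
  moreover have "(SUP b\<in>B. INF a\<in>A. d b a) = (SUP b\<in>B. INF a\<in>A. d a b)"
    by (simp add: commute)
  ultimately show ?thesis using hausdorff_dist_compact(1)[OF assms(1-4)] by simp
qed

text \<open>
  Points of \<open>A n\<close> have neighbours in \<open>L\<close> at distances tending to 0, and a subsequence of these
  neighbours converges because \<open>L\<close> is compact.
\<close>

lemma (in Metric_space) hausdorff_limit_subsequence:
  assumes A: "\<And>n. compactin mtopology (A n)" "\<And>n. A n \<noteq> {}"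
    and L: "compactin mtopology L" "L \<noteq> {}"
    and lim: "(\<lambda>n. hausdorff_dist d (A n) L) \<longlonglongrightarrow> 0"
    and z: "\<And>n. z n \<in> A n"
  shows "\<exists>l r. l \<in> L \<and> strict_mono r \<and> limitin mtopology (z \<circ> r) l sequentially"
proof -
  define e where "e n = hausdorff_dist d (A n) L + inverse (real (Suc n))" for n
  have e: "e \<longlonglongrightarrow> 0"
    unfolding e_def using tendsto_add[OF lim LIMSEQ_inverse_real_of_nat] by simp
  have "\<exists>w\<in>L. d (z n) w < e n" for n
    using hausdorff_dist_less_imp_near[OF A(1)[of n] L(1) A(2) L(2) _ z] by (simp add: e_def)
  then obtain w where w: "\<And>n. w n \<in> L" "\<And>n. d (z n) (w n) < e n" by metis
  obtain l r where l: "l \<in> L" "strict_mono r" and lw: "limitin mtopology (w \<circ> r) l sequentially"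
    using L(1) w(1) unfolding compactin_sequentially by (metis image_subset_iff)
  have sub: "L \<subseteq> M" "\<And>n. A n \<subseteq> M" using A L compactin_subspace by force+
  have "(\<lambda>n. e (r n) + d (w (r n)) l) \<longlonglongrightarrow> 0 + 0"
    using LIMSEQ_subseq_LIMSEQ[OF e l(2)] lw
    by (intro tendsto_add) (auto simp: limitin_metric_dist_null o_def)
  then have S: "(\<lambda>n. e (r n) + d (w (r n)) l) \<longlonglongrightarrow> 0" by simp
  have "d (z (r n)) l \<le> e (r n) + d (w (r n)) l" for n
    using triangle[of "z (r n)" "w (r n)" l] w[of "r n"] z sub l(1) by (smt (verit) subsetD)
  then have "(\<lambda>n. d (z (r n)) l) \<longlonglongrightarrow> 0"
    by (intro tendsto_sandwich[OF _ _ tendsto_const S]) auto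
  then have "limitin mtopology (z \<circ> r) l sequentially"
    using sub z l(1) unfolding limitin_metric_dist_null o_def by (meson always_eventually subsetD)
  with l show ?thesis by blast
qed

lemma (in Metric_space) hausdorff_limit_approximation:
  assumes A: "\<And>n. compactin mtopology (A n)" "\<And>n. A n \<noteq> {}"
    and L: "compactin mtopology L" "L \<noteq> {}"
    and lim: "(\<lambda>n. hausdorff_dist d (A n) L) \<longlonglongrightarrow> 0"
    and l: "l \<in> L"
  shows "\<exists>z. (\<forall>n. z n \<in> A n) \<and> limitin mtopology z l sequentially"
proof -
  define e where "e n = hausdorff_dist d (A n) L + inverse (real (Suc n))" for n
  have e: "e \<longlonglongrightarrow> 0"
    unfolding e_def using tendsto_add[OF lim LIMSEQ_inverse_real_of_nat] by simp
  have "\<exists>z\<in>A n. d l z < e n" for n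
    using hausdorff_dist_less_imp_near[OF L(1) A(1)[of n] L(2) A(2) _ l] 
    by (simp add: e_def hausdorff_dist_commute[of L])
  then obtain z where z: "\<And>n. z n \<in> A n" "\<And>n. d (z n) l < e n" by (metis commute)
  have sub: "L \<subseteq> M" "\<And>n. A n \<subseteq> M" using A L compactin_subspace by force+
  have "(\<lambda>n. d (z n) l) \<longlonglongrightarrow> 0"
    by (rule tendsto_sandwich[OF _ _ tendsto_const e]) (auto simp: less_imp_le z)
  then have "limitin mtopology z l sequentially"
    using sub z l unfolding limitin_metric_dist_null by (meson always_eventually subsetD)
  with z show ?thesis by blast
qed

lemma (in Metric_space) Metric_space_hausdorff:
  "Metric_space {A. compactin mtopology A \<and> A \<noteq> {} \<and> A \<subseteq> K} (hausdorff_dist d)"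
  by unfold_locales
    (auto simp: hausdorff_dist_nonneg hausdorff_dist_commute hausdorff_dist_zero
       intro: hausdorff_dist_triangle)

text \<open>
  If \<open>F\<close> is a finite \<open>e/2\<close>-net of \<open>K\<close>, then the finitely many nonempty subsets of \<open>F\<close> form an
  \<open>e\<close>-net of the hyperspace: a set \<open>A\<close> is close to the set of those net points that are close to \<open>A\<close>.
\<close>

lemma (in Metric_space) compact_hyperspace_totally_bounded:
  assumes K: "compactin mtopology K"
  defines "H \<equiv> {A. compactin mtopology A \<and> A \<noteq> {} \<and> A \<subseteq> K}"
  shows "Metric_space.mtotally_bounded H (hausdorff_dist d) H"
proof -
  interpret H: Metric_space H "hausdorff_dist d"
    unfolding H_def by (rule Metric_space_hausdorff)
  show ?thesis
    unfolding H.mtotally_bounded_def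
  proof (intro allI impI)
    fix e :: real assume e: "0 < e"
    obtain F where F: "finite F" "F \<subseteq> K" "K \<subseteq> (\<Union>x\<in>F. mball x (e/2))"
      using compactin_imp_mtotally_bounded[OF K] e unfolding mtotally_bounded_def
      by (meson half_gt_zero)
    have KM: "K \<subseteq> M" using K compactin_subspace by force
    have fin: "G \<in> H" if "G \<subseteq> F" "G \<noteq> {}" for G
    proof -
      have "finite G" using finite_subset[OF that(1) F(1)] .
      moreover have "G \<subseteq> M" "G \<subseteq> K" using that F(2) KM by blast+
      ultimately have "compactin mtopology G" by (simp add: finite_imp_compactin_eq)
      with \<open>G \<subseteq> K\<close> that(2) show ?thesis by (simp add: H_def)
    qed
    have "A \<in> (\<Union>G\<in>Pow F - {{}}. H.mball G e)" if A: "A \<in> H" for A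
    proof -
      define G where "G = {f \<in> F. \<exists>a\<in>A. d f a < e/2}"
      have AG: "\<exists>f\<in>G. d f a < e/2" if "a \<in> A" for a
      proof -
        have "a \<in> K" using A that by (auto simp: H_def)
        then obtain f where "f \<in> F" "a \<in> mball f (e/2)" using F(3) by blast
        then show ?thesis using that by (auto simp: G_def)
      qed
      have "A \<noteq> {}" using A by (simp add: H_def)
      with AG have "G \<noteq> {}" by blast
      then have GH: "G \<in> H" by (intro fin) (auto simp: G_def)
      have "hausdorff_dist d G A \<le> e/2"
      proof (rule hausdorff_dist_leI)
        show "\<exists>b\<in>A. d a b \<le> e/2" if "a \<in> G" for a
          using that by (auto simp: G_def intro: less_imp_le)
        show "\<exists>a\<in>G. d b a \<le> e/2" if "b \<in> A" for b
          using AG[OF that] commute by (metis less_imp_le)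
      qed (use A GH in \<open>auto simp: H_def\<close>)
      then have "A \<in> H.mball G e" using A GH e by simp
      then show ?thesis using \<open>G \<noteq> {}\<close> by (auto simp: G_def)
    qed
    then have cover: "H \<subseteq> (\<Union>G\<in>Pow F - {{}}. H.mball G e)" by (rule subsetI)
    have "finite (Pow F - {{}})" using F(1) by simp
    moreover have "Pow F - {{}} \<subseteq> H" using fin by auto
    ultimately show "\<exists>\<G>. finite \<G> \<and> \<G> \<subseteq> H \<and> H \<subseteq> (\<Union>G\<in>\<G>. H.mball G e)"
      using cover by blast
  qed
qed

text \<open>
  The limit of a Cauchy sequence of sets consists of the cluster points of sequences of points chosen
  from these sets. Compactness of \<open>K\<close> provides enough cluster points.
\<close>

lemma (in Metric_space) compact_hyperspace_complete:
  assumes K: "compactin mtopology K"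
  defines "H \<equiv> {A. compactin mtopology A \<and> A \<noteq> {} \<and> A \<subseteq> K}"
  shows "Metric_space.mcomplete H (hausdorff_dist d)"
proof -
  interpret H: Metric_space H "hausdorff_dist d"
    unfolding H_def by (rule Metric_space_hausdorff)
  have KM: "K \<subseteq> M" using K compactin_subspace by force
  show ?thesis
    unfolding H.mcomplete_def
  proof (intro allI impI)
    fix A assume A: "H.MCauchy A"
    then have AH: "A n \<in> H" for n by (auto simp: H.MCauchy_def)
    then have comp: "compactin mtopology (A n)" and ne: "A n \<noteq> {}" and AK: "A n \<subseteq> K" for n
      by (auto simp: H_def)
    define L where "L = (\<Inter>n. mtopology closure_of (\<Union>m\<in>{n..}. A m))"
    have cluster: "\<exists>l\<in>L. \<exists>r. strict_mono r \<and> limitin mtopology (z \<circ> r) l sequentially"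
      if z: "\<And>n. z n \<in> A (n + N)" for z N
    proof -
      have "range z \<subseteq> K" using z AK by blast
      then obtain l r where l: "l \<in> K" "strict_mono r" "limitin mtopology (z \<circ> r) l sequentially"
        using K unfolding compactin_sequentially by meson
      have "l \<in> mtopology closure_of (\<Union>m\<in>{n..}. A m)" for n
        unfolding metric_closure_of
      proof (clarify, intro conjI allI impI)
        show "l \<in> M" using l KM by blast
        fix e :: real assume "0 < e"
        then have "\<forall>\<^sub>F k in sequentially. z (r k) \<in> M \<and> d (z (r k)) l < e"
          using l(3) by (simp add: limitin_metric)
        moreover have "\<forall>\<^sub>F k in sequentially. n \<le> k" by (rule eventually_ge_at_top)
        ultimately have "\<forall>\<^sub>F k in sequentially. n \<le> k \<and> z (r k) \<in> M \<and> d (z (r k)) l < e"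
          by eventually_elim simp
        then obtain k where k: "n \<le> k" "z (r k) \<in> M" "d (z (r k)) l < e"
          using eventually_happens' sequentially_bot by blast
        have "n \<le> r k + N" using k(1) seq_suble[OF l(2), of k] by linarith
        then show "\<exists>y\<in>(\<Union>m\<in>{n..}. A m). y \<in> mball l e"
          using k z[of "r k"] \<open>l \<in> M\<close> commute by (intro bexI[of _ "z (r k)"]) auto
      qed
      then show ?thesis using l(2,3) by (auto simp: L_def)
    qed
    have Lcl: "closedin mtopology L" unfolding L_def by (intro closedin_Inter) auto
    have LK: "L \<subseteq> K"
    proof -
      have "closedin mtopology K"
        using K Hausdorff_space_mtopology compactin_imp_closedin by blast
      then have "mtopology closure_of (\<Union>m\<in>{0..}. A m) \<subseteq> K"
        using AK by (intro closure_of_minimal) auto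
      moreover have "L \<subseteq> mtopology closure_of (\<Union>m\<in>{0..}. A m)" unfolding L_def by blast
      ultimately show ?thesis by blast
    qed
    have LM: "L \<subseteq> M" using LK KM by blast
    have Lc: "compactin mtopology L" using closed_compactin[OF K LK Lcl] .
    have Lne: "L \<noteq> {}"
    proof -
      have "(SOME x. x \<in> A n) \<in> A (n + 0)" for n using ne[of n] some_in_eq by auto
      from cluster[OF this] show ?thesis by blast
    qed
    have LH: "L \<in> H" using Lc Lne LK by (simp add: H_def)
    have "\<exists>N. \<forall>n\<ge>N. hausdorff_dist d (A n) L < e" if e: "0 < e" for e
    proof -
      obtain N where N: "\<And>m n. N \<le> m \<Longrightarrow> N \<le> n \<Longrightarrow> hausdorff_dist d (A m) (A n) < e/4"
        using A e unfolding H.MCauchy_def by (meson zero_less_divide_iff zero_less_numeral)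
      have near: "\<exists>b\<in>A n. d a b < e/4" if "N \<le> m" "N \<le> n" "a \<in> A m" for m n a
        using hausdorff_dist_less_imp_near[OF comp comp ne ne N[OF that(1,2)] that(3)] .
      have "hausdorff_dist d (A n) L \<le> e/2" if n: "N \<le> n" for n
      proof (rule hausdorff_dist_leI[OF comp Lc ne Lne])
        fix x assume x: "x \<in> L"
        then have "x \<in> mtopology closure_of (\<Union>m\<in>{N..}. A m)" by (simp add: L_def)
        then obtain m y where y: "N \<le> m" "y \<in> A m" "y \<in> mball x (e/4)"
          using e unfolding metric_closure_of by (auto dest: spec[of _ "e/4"])
        obtain a where a: "a \<in> A n" "d y a < e/4" using near[OF y(1) n y(2)] by blast
        have "d x a \<le> d x y + d y a" using y a AK KM by (intro triangle) auto
        then show "\<exists>a\<in>A n. d x a \<le> e/2" using a y by (intro bexI[of _ a]) auto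
      next
        fix a assume a: "a \<in> A n"
        have "\<exists>z\<in>A (k + N). d a z < e/4" for k using near[OF n _ a] by simp
        then obtain z where z: "\<And>k. z k \<in> A (k + N)" "\<And>k. d a (z k) < e/4" by metis
        from cluster[OF z(1)] obtain l r where l: "l \<in> L"
          "limitin mtopology (z \<circ> r) l sequentially" by blast
        have "\<forall>\<^sub>F k in sequentially. z (r k) \<in> M \<and> d (z (r k)) l < e/4"
          using l(2) e unfolding limitin_metric o_def by (meson zero_less_divide_iff zero_less_numeral)
        then obtain k where k: "z (r k) \<in> M" "d (z (r k)) l < e/4"
          using eventually_happens' sequentially_bot by blast
        have "d a l \<le> d a (z (r k)) + d (z (r k)) l"
          using a k l(1) AK[of n] KM LM by (intro triangle) auto
        then show "\<exists>l\<in>L. d a l \<le> e/2" using z(2)[of "r k"] k(2) l(1) by (intro bexI[of _ l]) auto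
      qed
      then show ?thesis using e by (intro exI[of _ N]) fastforce
    qed
    then have "limitin H.mtopology A L sequentially"
      using LH AH by (simp add: H.limitin_metric eventually_sequentially)
    then show "\<exists>x. limitin H.mtopology A x sequentially" ..
  qed
qed

text \<open>
  Blaschke's selection theorem. It follows from the fact that a complete and totally bounded space is
  compact.
\<close>

theorem (in Metric_space) hausdorff_convergent_subsequence:
  fixes A :: "nat \<Rightarrow> 'a set"
  assumes K: "compactin mtopology K"
    and A: "\<And>n. compactin mtopology (A n)" "\<And>n. A n \<noteq> {}" "\<And>n. A n \<subseteq> K"
  shows "\<exists>L r. compactin mtopology L \<and> L \<noteq> {} \<and> strict_mono r \<and>
           (\<lambda>n. hausdorff_dist d (A (r n)) L) \<longlonglongrightarrow> 0"
proof -
  define H where "H = {A. compactin mtopology A \<and> A \<noteq> {} \<and> A \<subseteq> K}"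
  interpret H: Metric_space H "hausdorff_dist d"
    unfolding H_def by (rule Metric_space_hausdorff)
  have "compact_space H.mtopology"
    unfolding H.compact_space_eq_mcomplete_mtotally_bounded
    using compact_hyperspace_complete[OF K] compact_hyperspace_totally_bounded[OF K]
    by (simp add: H_def)
  moreover have "range A \<subseteq> H" using A by (auto simp: H_def)
  ultimately have "\<exists>L r. L \<in> H \<and> strict_mono r \<and> limitin H.mtopology (A \<circ> r) L sequentially"
    unfolding H.compact_space_sequentially by blast
  then obtain L r where "L \<in> H" "strict_mono r" "limitin H.mtopology (A \<circ> r) L sequentially"
    by blast
  moreover from this(3) have "(\<lambda>n. hausdorff_dist d (A (r n)) L) \<longlonglongrightarrow> 0"
    by (simp add: H.limitin_metric_dist_null o_def)
  ultimately show ?thesis by (auto simp: H_def)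
qed

section \<open>Precompact sets of space-time points\<close>

lemma continuous_on_time_of: "continuous_on UNIV (time_of :: 'a::metric_space squeezed \<Rightarrow> ereal)"
proof -
  have "open (time_of -` U :: 'a squeezed set)" if "open U" for U
    unfolding open_squeezed_def squeezed_converges_def
    using that topological_tendstoD by fastforce
  then show ?thesis by (simp add: continuous_on_open_vimage)
qed

lemma tendsto_Pt_iff: "(\<lambda>n. Pt (x n) (t n)) \<longlonglongrightarrow> Pt y s \<longleftrightarrow> x \<longlonglongrightarrow> y \<and> t \<longlonglongrightarrow> s"
  for y :: "'a::metric_space"
  by (auto simp: tendsto_squeezed_iff squeezed_converges_def)

lemma tendsto_time_of: "z \<longlonglongrightarrow> p \<Longrightarrow> (\<lambda>n. time_of (z n)) \<longlonglongrightarrow> time_of p"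
  for p :: "'a::metric_space squeezed"
  by (simp add: tendsto_squeezed_iff squeezed_converges_def)

text \<open>
  Times bounded by \<open>T\<close> cannot escape to the two end points, so a limit is a finite point and the
  positions converge as well.
\<close>

lemma bounded_time_limit:
  fixes p :: "'a::metric_space squeezed"
  assumes lim: "(\<lambda>n. Pt (x n) (t n)) \<longlonglongrightarrow> p" and T: "\<And>n. \<bar>t n\<bar> \<le> T"
  obtains y s where "p = Pt y s" "x \<longlonglongrightarrow> y" "t \<longlonglongrightarrow> s"
proof -
  have t: "(\<lambda>n. ereal (t n)) \<longlonglongrightarrow> time_of p" using tendsto_time_of[OF lim] by simp
  have "- T \<le> t n" "t n \<le> T" for n using T[of n] by auto
  then have "ereal (- T) \<le> time_of p" "time_of p \<le> ereal T"
    using LIMSEQ_le_const[OF t] LIMSEQ_le_const2[OF t] by (meson ereal_less_eq(3))+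
  then obtain y s where "p = Pt y s" by (cases p) auto
  with lim that show ?thesis by (simp add: tendsto_Pt_iff)
qed

text \<open>
  Times always have a convergent subsequence in the compact extended real line. If its limit \<open>t\<close> is
  finite, positions eventually lie in the compact set belonging to \<open>T = \<bar>t\<bar> + 1\<close>, and a second
  extraction makes them converge.
\<close>

lemma squeezed_convergent_subsequence:
  fixes z :: "nat \<Rightarrow> 'a::metric_space squeezed"
  assumes C: "\<And>T. \<exists>C. compact C \<and> (\<forall>n x t. z n = Pt x t \<longrightarrow> \<bar>t\<bar> \<le> T \<longrightarrow> x \<in> C)"
  shows "\<exists>l r. strict_mono r \<and> (z \<circ> r) \<longlonglongrightarrow> l"
proof -
  obtain a r where r: "strict_mono r" and a: "(time_of \<circ> z \<circ> r) \<longlonglongrightarrow> a"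
    using compact_complete_linorder[of "time_of \<circ> z"] by (auto simp: o_assoc)
  show ?thesis
  proof (cases a)
    case (real t)
    obtain C where "compact C" and xC: "\<And>n x s. z n = Pt x s \<Longrightarrow> \<bar>s\<bar> \<le> \<bar>t\<bar> + 1 \<Longrightarrow> x \<in> C"
      using C[of "\<bar>t\<bar> + 1"] by blast
    have "\<forall>\<^sub>F n in sequentially. ereal (t - 1) < time_of (z (r n))"
      "\<forall>\<^sub>F n in sequentially. time_of (z (r n)) < ereal (t + 1)"
      using order_tendstoD[OF a] real by (auto simp: o_def)
    then have "\<forall>\<^sub>F n in sequentially. pos_of (z (r n)) \<in> C"
    proof eventually_elim
      case (elim n)
      then obtain x s where "z (r n) = Pt x s" by (cases "z (r n)") auto
      with elim show ?case using xC[of "r n" x s] by simp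
    qed
    then obtain N where N: "\<And>n. n \<ge> N \<Longrightarrow> pos_of (z (r n)) \<in> C"
      by (auto simp: eventually_sequentially)
    then have "\<forall>n. pos_of (z (r (n + N))) \<in> C" by simp
    then obtain x q where q: "strict_mono q" "((\<lambda>n. pos_of (z (r (n + N)))) \<circ> q) \<longlonglongrightarrow> x"
      using compact_imp_seq_compact[OF \<open>compact C\<close>] unfolding seq_compact_def by meson
    define k where "k n = r (q n + N)" for n
    have "strict_mono (\<lambda>n. q n + N)" using q(1) by (simp add: strict_mono_def)
    then have k: "strict_mono k" and "(time_of \<circ> z \<circ> k) \<longlonglongrightarrow> a"
      using strict_mono_o[OF r, of "\<lambda>n. q n + N"] LIMSEQ_subseq_LIMSEQ[OF a, of "\<lambda>n. q n + N"]
      by (simp_all add: k_def[abs_def] o_def)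
    then have "(z \<circ> k) \<longlonglongrightarrow> Pt x t"
      using q(2) real by (simp add: tendsto_squeezed_iff squeezed_converges_def o_def k_def)
    with k show ?thesis by blast
  next
    case PInf
    then have "(z \<circ> r) \<longlonglongrightarrow> Pos_End"
      using a by (auto simp: tendsto_squeezed_iff squeezed_converges_def o_def)
    with r show ?thesis by blast
  next
    case MInf
    then have "(z \<circ> r) \<longlonglongrightarrow> Neg_End"
      using a by (auto simp: tendsto_squeezed_iff squeezed_converges_def o_def)
    with r show ?thesis by blast
  qed
qed

text \<open>
  A sequence of such positions comes with times in a bounded window, so that convergence of the
  space-time points entails convergence of the positions.
\<close>

lemma compact_positions:
  fixes S :: "'a::metric_space squeezed set"
  assumes S: "\<And>z :: nat \<Rightarrow> 'a squeezed. range z \<subseteq> S \<Longrightarrow> \<exists>l r. strict_mono r \<and> (z \<circ> r) \<longlonglongrightarrow> l"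
  shows "compact (closure {x. \<exists>t. Pt x t \<in> S \<and> \<bar>t\<bar> \<le> T})" (is "compact (closure ?C)")
proof -
  have "\<exists>l r. strict_mono r \<and> (\<sigma> \<circ> r) \<longlonglongrightarrow> l" if "range \<sigma> \<subseteq> ?C" for \<sigma> :: "nat \<Rightarrow> 'a"
  proof -
    have "\<exists>t. Pt (\<sigma> n) t \<in> S \<and> \<bar>t\<bar> \<le> T" for n using that by blast
    then obtain t where t: "\<And>n. Pt (\<sigma> n) (t n) \<in> S" "\<And>n. \<bar>t n\<bar> \<le> T" by metis
    then obtain l r where r: "strict_mono r" "(\<lambda>n. Pt (\<sigma> (r n)) (t (r n))) \<longlonglongrightarrow> l"
      using S[of "\<lambda>n. Pt (\<sigma> n) (t n)"] by (auto simp: o_def)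
    from bounded_time_limit[OF r(2) t(2)] obtain x where "(\<lambda>n. \<sigma> (r n)) \<longlonglongrightarrow> x" by blast
    with r(1) show ?thesis by (auto simp: o_def)
  qed
  then show ?thesis
    using Met_TC.compact_closure_of_sequentially[of ?C] by simp
qed

section \<open>Continuous paths as graphs\<close>

lemma path_lims_singleton:
  assumes "{x. Pt x t \<in> fst p} = {y}" "(Pt y t, Pt y t) \<in> snd p"
  shows "path_lims p t = (y, y)"
  unfolding path_lims_def assms(1)
  by (rule the_equality) (use assms(2) in \<open>auto simp: doubleton_eq_iff\<close>)

lemma path_at_eq:
  assumes p: "p \<in> Cpath_space" and x: "Pt x t \<in> fst p"
  shows "path_at p t = x"
proof -
  have "{y. Pt y t \<in> fst p} = {x}" using Cpath_unique[OF p] x by fastforce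
  moreover have "(Pt x t, Pt x t) \<in> snd p" using Cpath_order_determined[OF p] x by auto
  ultimately show ?thesis by (simp add: path_left_def path_lims_singleton)
qed

lemma path_times_iff:
  assumes "p \<in> Cpath_space"
  shows "t \<in> path_times p \<longleftrightarrow> Pt (path_at p t) t \<in> fst p"
  using path_at_eq[OF assms] by (auto simp: path_times_def)

text \<open>
  As different points have different times, comparing times is a total order on \<open>P\<close>; it is closed
  because time depends continuously on the point.
\<close>

lemma Cpath_spaceI:
  fixes P :: "'a::metric_space squeezed set"
  assumes P: "compact P" "P \<noteq> {}" and inj: "inj_on time_of P"
  defines "R \<equiv> {(z, z'). z \<in> P \<and> z' \<in> P \<and> time_of z \<le> time_of z'}"
  shows "(P, R) \<in> Cpath_space"
proof -
  have sing: "\<exists>x. {x. Pt x t \<in> P} = {x}" if "Pt y t \<in> P" for y t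
    using that inj by (force simp: inj_on_def)
  have "linear_order_on P R"
    unfolding linear_order_on_def partial_order_on_def preorder_on_def
    using inj by (auto simp: R_def refl_on_def trans_def antisym_def total_on_def inj_on_def)
  moreover have "closedin (top_of_set (P \<times> P)) R"
  proof -
    have "closed {w::'a squeezed \<times> 'a squeezed. time_of (fst w) \<le> time_of (snd w)}"
      by (intro closed_Collect_le continuous_on_compose2[OF continuous_on_time_of]
            continuous_intros) auto
    moreover have "R = (P \<times> P) \<inter> {w. time_of (fst w) \<le> time_of (snd w)}"
      by (auto simp: R_def)
    ultimately show ?thesis by (simp add: closedin_closed_Int)
  qed
  moreover have "finite {x. Pt x t \<in> P} \<and> card {x. Pt x t \<in> P} \<le> 2" for t
  proof (cases "{x. Pt x t \<in> P} = {}")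
    case False
    then obtain x where "{x. Pt x t \<in> P} = {x}" using sing by blast
    then show ?thesis by simp
  qed simp
  ultimately have "(P, R) \<in> Path_space"
    using P by (auto simp: Path_space_def R_def less_imp_le)
  moreover have "path_left (P, R) t = path_right (P, R) t" if "t \<in> path_times (P, R)" for t
  proof -
    obtain y where "Pt y t \<in> P"
      using \<open>t \<in> path_times (P, R)\<close> by (auto simp: path_times_def)
    then obtain x where x: "{x. Pt x t \<in> P} = {x}" using sing by blast
    then have "(Pt x t, Pt x t) \<in> R" by (auto simp: R_def)
    with x show ?thesis by (simp add: path_left_def path_right_def path_lims_singleton)
  qed
  ultimately show ?thesis by (simp add: Cpath_space_def)
qed

lemma compact_containment_iff:
  assumes A: "A \<subseteq> Cpath_space"
  shows "compact_containment A \<longleftrightarrow>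
    (\<forall>T. \<exists>C. compact C \<and> (\<forall>p\<in>A. \<forall>x t. Pt x t \<in> fst p \<longrightarrow> \<bar>t\<bar> \<le> T \<longrightarrow> x \<in> C))"
proof -
  have "(\<forall>t\<in>path_times p \<inter> {-T..T}. path_at p t \<in> C) \<longleftrightarrow>
        (\<forall>x t. Pt x t \<in> fst p \<longrightarrow> \<bar>t\<bar> \<le> T \<longrightarrow> x \<in> C)" if "p \<in> A" for p T C
  proof -
    have p: "p \<in> Cpath_space" using A that by blast
    have "t \<in> {-T..T} \<longleftrightarrow> \<bar>t\<bar> \<le> T" for t by auto
    then show ?thesis
      using path_at_eq[OF p] path_times_iff[OF p] by (metis IntE IntI)
  qed
  then show ?thesis unfolding compact_containment_def by simp
qed

text \<open>
  The set \<open>G\<close> stands for the graph of a path. Speaking of points of the graph rather than of values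
  of the path makes the condition meaningful for arbitrary sets, and lets it be combined directly with
  convergence of points. Times are unordered and may coincide; for a continuous path and \<open>e \<ge> 0\<close> this
  agrees with the modulus of continuity, as equal times mean equal positions and distances are symmetric.
\<close>

definition osc_le :: "real \<Rightarrow> real \<Rightarrow> real \<Rightarrow> 'a::metric_space squeezed set \<Rightarrow> bool" where
  "osc_le T \<delta> e G \<longleftrightarrow> (\<forall>x y s t. Pt x s \<in> G \<longrightarrow> Pt y t \<in> G \<longrightarrow>
     \<bar>s\<bar> \<le> T \<longrightarrow> \<bar>t\<bar> \<le> T \<longrightarrow> \<bar>s - t\<bar> \<le> \<delta> \<longrightarrow> dist x y \<le> e)"

lemma osc_le_mono: "osc_le T \<delta> e G \<Longrightarrow> \<delta>' \<le> \<delta> \<Longrightarrow> osc_le T \<delta>' e G"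
  unfolding osc_le_def by (meson order_trans)

lemma modulus_le_iff:
  assumes p: "p \<in> Cpath_space" and e: "0 \<le> e"
  shows "modulus T \<delta> p \<le> ennreal e \<longleftrightarrow> osc_le T \<delta> e (fst p)"
proof
  assume m: "modulus T \<delta> p \<le> ennreal e"
  have less: "dist x y \<le> e"
    if "Pt x s \<in> fst p" "Pt y t \<in> fst p" "\<bar>s\<bar> \<le> T" "\<bar>t\<bar> \<le> T" "\<bar>s - t\<bar> \<le> \<delta>" "s < t" for x y s t
  proof -
    have "s \<in> path_times p" "t \<in> path_times p" using that by (auto simp: path_times_def)
    then have "ennreal (dist (path_at p s) (path_at p t)) \<le> modulus T \<delta> p"
      unfolding modulus_def using that by (intro Sup_upper) (auto intro!: exI)
    also note m
    finally show ?thesis using that e p by (simp add: path_at_eq)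
  qed
  show "osc_le T \<delta> e (fst p)"
    unfolding osc_le_def
  proof (intro allI impI)
    fix x y s t
    assume h: "Pt x s \<in> fst p" "Pt y t \<in> fst p" "\<bar>s\<bar> \<le> T" "\<bar>t\<bar> \<le> T" "\<bar>s - t\<bar> \<le> \<delta>"
    consider "s < t" | "t < s" | "s = t" by linarith
    then show "dist x y \<le> e"
    proof cases
      case 3
      then have "x = y" using Cpath_unique[OF p h(1,2)] by simp
      then show ?thesis using e by simp
    qed (use less[of x s y t] less[of y t x s] h in \<open>auto simp: dist_commute abs_minus_commute\<close>)
  qed
next
  assume "osc_le T \<delta> e (fst p)"
  then show "modulus T \<delta> p \<le> ennreal e"
    unfolding modulus_def osc_le_def using path_times_iff[OF p] by (intro Sup_least) (force intro!: ennreal_leI)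
qed

text \<open>
  Since the condition on the right is monotone in \<open>\<delta>\<close>, the limit as \<open>\<delta>\<close> decreases to 0 amounts to the
  existence of one suitable \<open>\<delta>\<close> for each \<open>e\<close>.
\<close>

lemma path_equicontinuous_iff:
  assumes A: "A \<subseteq> Cpath_space"
  shows "path_equicontinuous A \<longleftrightarrow>
    (\<forall>T>0. \<forall>e>0. \<exists>\<delta>>0. \<forall>p\<in>A. osc_le T \<delta> e (fst p))"
    (is "_ \<longleftrightarrow> (\<forall>T>0. \<forall>e>0. \<exists>\<delta>>0. ?Q T e \<delta>)")
proof -
  have Q: "(SUP p\<in>A. modulus T \<delta> p) \<le> ennreal e \<longleftrightarrow> ?Q T e \<delta>" if "0 \<le> e" for T e \<delta>
    by (simp add: SUP_le_iff modulus_le_iff[OF subsetD[OF A] that] cong: ball_cong)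
  have "((\<lambda>\<delta>. SUP p\<in>A. modulus T \<delta> p) \<longlongrightarrow> 0) (at_right 0) \<longleftrightarrow> (\<forall>e>0. \<exists>\<delta>>0. ?Q T e \<delta>)" for T
  proof
    assume L: "((\<lambda>\<delta>. SUP p\<in>A. modulus T \<delta> p) \<longlongrightarrow> 0) (at_right 0)"
    show "\<forall>e>0. \<exists>\<delta>>0. ?Q T e \<delta>"
    proof (intro allI impI)
      fix e :: real assume e: "0 < e"
      then have "\<forall>\<^sub>F \<delta> in at_right 0. (SUP p\<in>A. modulus T \<delta> p) < ennreal e"
        by (intro order_tendstoD(2)[OF L]) simp
      then obtain b where b: "0 < b" "\<And>\<delta>. 0 < \<delta> \<Longrightarrow> \<delta> < b \<Longrightarrow> (SUP p\<in>A. modulus T \<delta> p) < ennreal e"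
        unfolding eventually_at_right_field by blast
      then have "(SUP p\<in>A. modulus T (b/2) p) \<le> ennreal e" by (intro less_imp_le b(2)) auto
      then have "?Q T e (b/2)" using Q[of e T "b/2"] e by simp
      then show "\<exists>\<delta>>0. ?Q T e \<delta>" using b(1) by (intro exI[of _ "b/2"] conjI) auto
    qed
  next
    assume R: "\<forall>e>0. \<exists>\<delta>>0. ?Q T e \<delta>"
    show "((\<lambda>\<delta>. SUP p\<in>A. modulus T \<delta> p) \<longlongrightarrow> 0) (at_right 0)"
    proof (rule order_tendstoI)
      fix a :: ennreal assume "0 < a"
      then obtain c where c: "0 < c" "c < a" using dense by blast
      then obtain e where e: "c = ennreal e" "0 < e" by (cases c) auto
      with R obtain \<delta> where \<delta>: "0 < \<delta>" "?Q T e \<delta>" by blast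
      have "(SUP p\<in>A. modulus T \<delta>' p) < a" if "0 < \<delta>'" "\<delta>' < \<delta>" for \<delta>'
      proof -
        have "?Q T e \<delta>'" using \<delta>(2) that(2) by (auto intro: osc_le_mono)
        then show ?thesis using Q[of e T \<delta>'] e c(2) by (auto intro: le_less_trans)
      qed
      then show "\<forall>\<^sub>F \<delta> in at_right 0. (SUP p\<in>A. modulus T \<delta> p) < a"
        unfolding eventually_at_right_field using \<delta>(1) by blast
    qed simp
  qed
  then show ?thesis unfolding path_equicontinuous_def by simp
qed

section \<open>The precompactness criterion\<close>

text \<open>
  In time the approximating points \<open>u n\<close> and \<open>v n\<close> of \<open>G n\<close> both approach \<open>t\<close>, hence each other; a common
  modulus of continuity then bounds the distance of their positions by any \<open>e > 0\<close> for large \<open>n\<close>. The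
  sets \<open>G n\<close> will be graphs of paths that converge to a set containing both limit points.
\<close>

lemma equicontinuous_limit_position_unique:
  fixes G :: "nat \<Rightarrow> 'a::metric_space squeezed set"
  assumes equi: "\<And>T e. 0 < T \<Longrightarrow> 0 < e \<Longrightarrow> \<exists>\<delta>>0. \<forall>n. osc_le T \<delta> e (G n)"
    and u: "\<And>n. u n \<in> G n" "u \<longlonglongrightarrow> Pt x t" and v: "\<And>n. v n \<in> G n" "v \<longlonglongrightarrow> Pt y t"
  shows "x = y"
proof -
  have pos: "(\<lambda>n. pos_of (u n)) \<longlonglongrightarrow> x" "(\<lambda>n. pos_of (v n)) \<longlonglongrightarrow> y"
    and time: "(\<lambda>n. time_of (u n)) \<longlonglongrightarrow> ereal t" "(\<lambda>n. time_of (v n)) \<longlonglongrightarrow> ereal t"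
    using u(2) v(2) by (auto simp: tendsto_squeezed_iff squeezed_converges_def)
  have near: "\<forall>\<^sub>F n in sequentially. \<exists>x s. w n = Pt x s \<and> \<bar>s - t\<bar> < \<eta>"
    if w: "(\<lambda>n. time_of (w n)) \<longlonglongrightarrow> ereal t" and "0 < \<eta>" for w :: "nat \<Rightarrow> 'a squeezed" and \<eta>
  proof -
    have "\<forall>\<^sub>F n in sequentially. ereal (t - \<eta>) < time_of (w n)"
      "\<forall>\<^sub>F n in sequentially. time_of (w n) < ereal (t + \<eta>)"
      using order_tendstoD[OF w] \<open>0 < \<eta>\<close> by auto
    then show ?thesis
    proof eventually_elim
      case (elim n)
      then show ?case by (cases "w n") (auto simp: abs_less_iff)
    qed
  qed
  have "dist x y \<le> e" if "0 < e" for e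
  proof -
    have "0 < \<bar>t\<bar> + 1" by simp
    from equi[OF this that] obtain \<delta> where \<delta>: "0 < \<delta>" and d: "\<And>n. osc_le (\<bar>t\<bar> + 1) \<delta> e (G n)"
      by blast
    (* Points within \<eta> of t in time have times in the window [-(\<bar>t\<bar> + 1), \<bar>t\<bar> + 1] and differ in time by at most \<delta>. *)
    define \<eta> where "\<eta> = min 1 (\<delta>/2)"
    have "0 < \<eta>" using \<delta> by (simp add: \<eta>_def)
    have "\<forall>\<^sub>F n in sequentially. dist (pos_of (u n)) (pos_of (v n)) \<le> e"
      using near[OF time(1) \<open>0 < \<eta>\<close>] near[OF time(2) \<open>0 < \<eta>\<close>]
    proof eventually_elim
      case (elim n)
      then obtain x' s y' s' where n: "u n = Pt x' s" "\<bar>s - t\<bar> < \<eta>" "v n = Pt y' s'" "\<bar>s' - t\<bar> < \<eta>"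
        by blast
      then have "\<bar>s\<bar> \<le> \<bar>t\<bar> + 1" "\<bar>s'\<bar> \<le> \<bar>t\<bar> + 1" "\<bar>s - s'\<bar> \<le> \<delta>" unfolding \<eta>_def by linarith+
      then show ?case using d[of n] u(1)[of n] v(1)[of n] n unfolding osc_le_def by simp
    qed
    then show ?thesis
      by (intro tendsto_upperbound[OF tendsto_dist[OF pos]]) auto
  qed
  then have "dist x y \<le> 0" by (rule field_le_epsilon) auto
  then show ?thesis by simp
qed

theorem theorem1p11:
  fixes D :: "'a::metric_space squeezed \<Rightarrow> 'a squeezed \<Rightarrow> real"
    and A :: "'a opath set"
  assumes "Metric_space UNIV D"
    and "Metric_space.mtopology UNIV D = euclidean"
    and "A \<subseteq> Cpath_space"
  shows "compactin (Cpath_topology D) (Cpath_topology D closure_of A) \<longleftrightarrow>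
         path_equicontinuous A \<and> compact_containment A"
proof -
  interpret S: Metric_space UNIV D by fact
  interpret C: Metric_space Cpath_space "path_dist D"
    using assms(1,2) by (rule Metric_space_Cpath)
  have graph: "compactin S.mtopology (fst p)" "fst p \<noteq> {}" if "p \<in> Cpath_space" for p
    using that by (auto simp: assms(2) Cpath_space_def Path_space_def)
  have precompact: "compactin (Cpath_topology D) (Cpath_topology D closure_of A) \<longleftrightarrow>
    (\<forall>\<sigma>::nat \<Rightarrow> _. range \<sigma> \<subseteq> A \<longrightarrow> (\<exists>p r. p \<in> Cpath_space \<and> strict_mono r \<and>
       (\<lambda>n. hausdorff_dist D (fst (\<sigma> (r n))) (fst p)) \<longlonglongrightarrow> 0))"
  proof -
    have lim: "limitin C.mtopology (\<sigma> \<circ> r) p sequentially \<longleftrightarrow>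
      (\<lambda>n. hausdorff_dist D (fst (\<sigma> (r n))) (fst p)) \<longlonglongrightarrow> 0"
      if "range \<sigma> \<subseteq> A" "p \<in> Cpath_space" for \<sigma> :: "nat \<Rightarrow> 'a opath" and r p
    proof -
      have "\<sigma> n \<in> Cpath_space" for n using that(1) assms(3) by blast
      then show ?thesis using that(2) by (simp add: C.limitin_metric_dist_null o_def path_dist_def)
    qed
    then show ?thesis
      unfolding Cpath_topology_def C.compact_closure_of_sequentially[OF assms(3)]
      by (simp add: lim cong: imp_cong conj_cong)
  qed
  have subseq: "\<exists>l\<in>fst p. \<exists>r. strict_mono r \<and> (\<lambda>n. z (r n)) \<longlonglongrightarrow> l"
    if "\<And>n. \<sigma> n \<in> A" "p \<in> Cpath_space" "(\<lambda>n. hausdorff_dist D (fst (\<sigma> n)) (fst p)) \<longlonglongrightarrow> 0"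
      "\<And>n. z n \<in> fst (\<sigma> n)" for \<sigma> p z
  proof -
    have "\<sigma> n \<in> Cpath_space" for n using that(1) assms(3) by blast
    from S.hausdorff_limit_subsequence[OF graph[OF this] graph[OF that(2)] that(3,4)]
    show ?thesis by (auto simp: assms(2) o_def)
  qed
  show ?thesis
  proof
    assume "compactin (Cpath_topology D) (Cpath_topology D closure_of A)"
    then have limit: "\<exists>p r. p \<in> Cpath_space \<and> strict_mono r \<and>
       (\<lambda>n. hausdorff_dist D (fst (\<sigma> (r n))) (fst p)) \<longlonglongrightarrow> 0"
      if "\<And>n. \<sigma> n \<in> A" for \<sigma> :: "nat \<Rightarrow> 'a opath"
      using that precompact by blast
    have "path_equicontinuous A"
    proof (rule ccontr)
      assume "\<not> path_equicontinuous A"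
      then obtain T e where e: "0 < e" and osc: "\<And>\<delta>. 0 < \<delta> \<Longrightarrow> \<exists>p\<in>A. \<not> osc_le T \<delta> e (fst p)"
        unfolding path_equicontinuous_iff[OF assms(3)] by blast
      have "\<exists>p x y s t. p \<in> A \<and> Pt x s \<in> fst p \<and> Pt y t \<in> fst p \<and> \<bar>s\<bar> \<le> T \<and> \<bar>t\<bar> \<le> T \<and>
          \<bar>s - t\<bar> \<le> inverse (real (Suc n)) \<and> e < dist x y" for n
      proof -
        have "0 < inverse (real (Suc n))" by simp
        from osc[OF this] obtain p where "p \<in> A" "\<not> osc_le T (inverse (real (Suc n))) e (fst p)"
          by blast
        then show ?thesis unfolding osc_le_def not_all not_imp not_le by blast
      qed
      then obtain p x y s t where pA: "\<And>n. p n \<in> A"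
        and x: "\<And>n. Pt (x n) (s n) \<in> fst (p n)" "\<And>n. \<bar>s n\<bar> \<le> T"
        and y: "\<And>n. Pt (y n) (t n) \<in> fst (p n)" "\<And>n. \<bar>t n\<bar> \<le> T"
        and st: "\<And>n. \<bar>s n - t n\<bar> \<le> inverse (real (Suc n))"
        and far: "\<And>n. e < dist (x n) (y n)"
        by metis
      obtain q r where q: "q \<in> Cpath_space" and r: "strict_mono r"
        and pq: "(\<lambda>n. hausdorff_dist D (fst (p (r n))) (fst q)) \<longlonglongrightarrow> 0"
        using limit[of p] pA by blast
      (* The point (x n, s n) converges along r o j. A further subsequence k, taken inside r o j, makes
         (y n, t n) converge as well, so that both limits are reached along i = r o j o k. *)
      obtain l j where l: "l \<in> fst q" and j: "strict_mono j"
        and xl: "(\<lambda>n. Pt (x (r (j n))) (s (r (j n)))) \<longlonglongrightarrow> l"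
        using subseq[of "\<lambda>n. p (r n)" q "\<lambda>n. Pt (x (r n)) (s (r n))"] pA q pq x(1) by blast
      obtain x' t' where x': "l = Pt x' t'" "(\<lambda>n. x (r (j n))) \<longlonglongrightarrow> x'" "(\<lambda>n. s (r (j n))) \<longlonglongrightarrow> t'"
        by (rule bounded_time_limit[OF xl x(2)])
      have pj: "(\<lambda>n. hausdorff_dist D (fst (p (r (j n)))) (fst q)) \<longlonglongrightarrow> 0"
        using LIMSEQ_subseq_LIMSEQ[OF pq j] by (simp add: o_def)
      obtain m k where m: "m \<in> fst q" and k: "strict_mono k"
        and ym: "(\<lambda>n. Pt (y (r (j (k n)))) (t (r (j (k n))))) \<longlonglongrightarrow> m"
        using subseq[of "\<lambda>n. p (r (j n))" q "\<lambda>n. Pt (y (r (j n))) (t (r (j n)))"] pA q pj y(1)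
        by blast
      obtain y' t'' where y': "m = Pt y' t''" "(\<lambda>n. y (r (j (k n)))) \<longlonglongrightarrow> y'"
          "(\<lambda>n. t (r (j (k n)))) \<longlonglongrightarrow> t''"
        by (rule bounded_time_limit[OF ym y(2)])
      define i where "i n = r (j (k n))" for n
      have i: "strict_mono i" using r j k by (simp add: i_def strict_mono_def)
      have xi: "(\<lambda>n. x (i n)) \<longlonglongrightarrow> x'" and si: "(\<lambda>n. s (i n)) \<longlonglongrightarrow> t'"
        using LIMSEQ_subseq_LIMSEQ[OF x'(2) k] LIMSEQ_subseq_LIMSEQ[OF x'(3) k]
        by (simp_all add: i_def o_def)
      have "(\<lambda>n. s n - t n) \<longlonglongrightarrow> 0"
        by (rule Lim_null_comparison[OF _ LIMSEQ_inverse_real_of_nat])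
          (use st in \<open>simp del: of_nat_Suc\<close>)
      then have "(\<lambda>n. s (i n) - t (i n)) \<longlonglongrightarrow> 0"
        using LIMSEQ_subseq_LIMSEQ[OF _ i] by (force simp: o_def)
      moreover have "(\<lambda>n. s (i n) - t (i n)) \<longlonglongrightarrow> t' - t''"
        using si y'(3) by (intro tendsto_diff) (simp_all add: i_def)
      ultimately have "0 = t' - t''" by (rule LIMSEQ_unique)
      then have "t' = t''" by simp
      then have "x' = y'" using Cpath_unique[OF q l m] x'(1) y'(1) by simp
      then have "(\<lambda>n. dist (x (i n)) (y (i n))) \<longlonglongrightarrow> dist x' x'"
        using xi y'(2) by (intro tendsto_dist) (simp_all add: i_def)
      then have "e \<le> dist x' x'" using far by (intro LIMSEQ_le_const) (auto intro: less_imp_le)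
      then show False using e by simp
    qed
    moreover have "compact_containment A"
      unfolding compact_containment_iff[OF assms(3)]
    proof
      fix T
      have "\<exists>l r. strict_mono r \<and> (z \<circ> r) \<longlonglongrightarrow> l" if z: "range z \<subseteq> (\<Union>p\<in>A. fst p)"
        for z :: "nat \<Rightarrow> 'a squeezed"
      proof -
        have "\<exists>p\<in>A. z n \<in> fst p" for n using z by blast
        then obtain p where p: "\<And>n. p n \<in> A" "\<And>n. z n \<in> fst (p n)" by metis
        obtain q r where q: "q \<in> Cpath_space" and r: "strict_mono r"
          and pq: "(\<lambda>n. hausdorff_dist D (fst (p (r n))) (fst q)) \<longlonglongrightarrow> 0"
          using limit[of p] p(1) by blast
        obtain l j where "strict_mono j" "(\<lambda>n. z (r (j n))) \<longlonglongrightarrow> l"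
          using subseq[of "\<lambda>n. p (r n)" q "\<lambda>n. z (r n)"] p q pq by blast
        with r show ?thesis
          by (intro exI[of _ l] exI[of _ "r \<circ> j"]) (simp add: o_def strict_mono_def)
      qed
      then have "compact (closure {x. \<exists>t. Pt x t \<in> (\<Union>p\<in>A. fst p) \<and> \<bar>t\<bar> \<le> T})" (is "compact (closure ?X)")
        by (rule compact_positions)
      moreover have "x \<in> closure ?X" if "p \<in> A" "Pt x t \<in> fst p" "\<bar>t\<bar> \<le> T" for p x t
        using that by (intro subsetD[OF closure_subset]) blast
      ultimately show "\<exists>C. compact C \<and> (\<forall>p\<in>A. \<forall>x t. Pt x t \<in> fst p \<longrightarrow> \<bar>t\<bar> \<le> T \<longrightarrow> x \<in> C)"
        by (intro exI[of _ "closure ?X"] conjI ballI allI impI)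
    qed
    ultimately show "path_equicontinuous A \<and> compact_containment A" ..
  next
    assume "path_equicontinuous A \<and> compact_containment A"
    then have equi: "path_equicontinuous A" and cc: "compact_containment A" by auto
    define K where "K = S.mtopology closure_of (\<Union>p\<in>A. fst p)"
    have K: "compactin S.mtopology K"
      unfolding K_def S.compact_closure_of_sequentially[OF subset_UNIV]
    proof (intro allI impI)
      fix z :: "nat \<Rightarrow> 'a squeezed" assume z: "range z \<subseteq> (\<Union>p\<in>A. fst p)"
      have "\<exists>l r. strict_mono r \<and> (z \<circ> r) \<longlonglongrightarrow> l"
      proof (rule squeezed_convergent_subsequence)
        fix T
        obtain C where "compact C" and C: "\<forall>p\<in>A. \<forall>x t. Pt x t \<in> fst p \<longrightarrow> \<bar>t\<bar> \<le> T \<longrightarrow> x \<in> C"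
          using cc unfolding compact_containment_iff[OF assms(3)] by (elim allE[of _ T] exE conjE)
        have "x \<in> C" if "z n = Pt x t" "\<bar>t\<bar> \<le> T" for n x t
        proof -
          have "z n \<in> (\<Union>p\<in>A. fst p)" using z by blast
          then obtain p where "p \<in> A" "z n \<in> fst p" by blast
          with C that show ?thesis by auto
        qed
        with \<open>compact C\<close> show "\<exists>C. compact C \<and> (\<forall>n x t. z n = Pt x t \<longrightarrow> \<bar>t\<bar> \<le> T \<longrightarrow> x \<in> C)"
          by (intro exI[of _ C] conjI allI impI)
      qed
      then show "\<exists>l r. l \<in> UNIV \<and> strict_mono r \<and> limitin S.mtopology (z \<circ> r) l sequentially"
        by (simp add: assms(2))
    qed
    have AK: "fst p \<subseteq> K" if "p \<in> A" for p
    proof -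
      have "fst p \<subseteq> (\<Union>p\<in>A. fst p)" using that by blast
      also have "\<dots> \<subseteq> K" unfolding K_def by (rule closure_of_subset) simp
      finally show ?thesis .
    qed
    show "compactin (Cpath_topology D) (Cpath_topology D closure_of A)"
      unfolding precompact
    proof (intro allI impI)
      fix \<sigma> :: "nat \<Rightarrow> 'a opath" assume "range \<sigma> \<subseteq> A"
      then have \<sigma>: "\<sigma> n \<in> A" "\<sigma> n \<in> Cpath_space" for n using assms(3) by auto
      obtain L r where L: "compactin S.mtopology L" "L \<noteq> {}" and r: "strict_mono r"
        and lim: "(\<lambda>n. hausdorff_dist D (fst (\<sigma> (r n))) L) \<longlonglongrightarrow> 0"
        using S.hausdorff_convergent_subsequence
          [of K "\<lambda>n. fst (\<sigma> n)", OF K graph[OF \<sigma>(2)] AK[OF \<sigma>(1)]] by (elim exE conjE)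
      (* Every point of L is a limit of points of the graphs, along the whole sequence and not just along
         a subsequence; two points of L can therefore be approximated from the same graphs. *)
      have approx: "\<exists>u. (\<forall>n. u n \<in> fst (\<sigma> (r n))) \<and> u \<longlonglongrightarrow> l" if "l \<in> L" for l
        using S.hausdorff_limit_approximation
          [of "\<lambda>n. fst (\<sigma> (r n))", OF graph[OF \<sigma>(2)] L lim that]
        by (simp add: assms(2))
      have uniq: "x = y" if xy: "Pt x t \<in> L" "Pt y t \<in> L" for x y t
      proof -
        obtain u v where u: "\<And>n. u n \<in> fst (\<sigma> (r n))" "u \<longlonglongrightarrow> Pt x t"
          and v: "\<And>n. v n \<in> fst (\<sigma> (r n))" "v \<longlonglongrightarrow> Pt y t"
          using approx[OF xy(1)] approx[OF xy(2)] by blast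
        show ?thesis
        proof (rule equicontinuous_limit_position_unique[OF _ u v])
          fix T e :: real assume "0 < T" "0 < e"
          then have "\<exists>\<delta>>0. \<forall>p\<in>A. osc_le T \<delta> e (fst p)"
            using equi unfolding path_equicontinuous_iff[OF assms(3)] by simp
          with \<sigma>(1) show "\<exists>\<delta>>0. \<forall>n. osc_le T \<delta> e (fst (\<sigma> (r n)))" by meson
        qed
      qed
      have "inj_on time_of L"
      proof (rule inj_onI)
        fix z z' assume z: "z \<in> L" "z' \<in> L" "time_of z = time_of z'"
        show "z = z'"
        proof (cases z)
          case (Pt x t)
          then obtain y where "z' = Pt y t" using z(3) by (cases z') auto
          then show ?thesis using uniq[of x t y] z Pt by simp
        qed (use z(3) in \<open>cases z'; simp\<close>)+
      qed
      then obtain R where "(L, R) \<in> Cpath_space"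
        using Cpath_spaceI[of L] L by (auto simp: assms(2))
      with r lim show "\<exists>p r. p \<in> Cpath_space \<and> strict_mono r \<and>
          (\<lambda>n. hausdorff_dist D (fst (\<sigma> (r n))) (fst p)) \<longlonglongrightarrow> 0"
        by (intro exI[of _ "(L, R)"] exI[of _ r] conjI) (simp_all only: fst_conv)
    qed
  qed
qed

end
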